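(* Let $V$ be a finite dimensional $\Gamma$-graded vector space and $\mathfrak{gl}(V)$ its general linear Lie $(\Gamma,\omega)$-algebra. Then: (1) Any finite dimensional simple $\mathfrak{gl}(V)$-module is a highest weight module (with respect to the Borel subalgebra $\mathfrak b=\mathfrak h+\mathfrak n$). (2) The simple $\mathfrak{gl}(V)$-module $L_\lambda$ with highest weight $\lambda\in\mathfrak h^*$ is finite dimensional if and only if $\lambda\in\Lambda_{M_+|M_-}$, where $$\Lambda_{M_+|M_-}=\Big\{\lambda\in\mathfrak h^*\ \Big|\ \tfrac{2(\lambda,\Upsilon)}{(\Upsilon,\Upsilon)}\in\mathbb Z_{\ge 0}\ \text{ for all }\Upsilon\in\Phi_0^+\Big\}.$$
   Context: All vector spaces are over $\mathbb C$. $\Gamma$ is an additive abelian group with a commutative factor $\omega:\Gamma\times\Gamma\to\mathbb C^*$, i.e. $\omega(\alpha,\beta)=\omega(\beta,\alpha)^{-1}$, $\omega(\alpha,\beta+\gamma)=\omega(\alpha,\beta)\omega(\alpha,\gamma)$, $\omega(\alpha+\beta,\gamma)=\omega(\alpha,\gamma)\omega(\beta,\gamma)$. Then $\omega(\alpha,\alpha)=\pm1$; put $\Gamma^\pm=\{\alpha:\omega(\alpha,\alpha)=\pm1\}$. $d(x)$ denotes the degree of a homogeneous element $x$; formulas written with $d(\cdot)$ are for homogeneous elements and extended linearly. $V=\bigoplus_{\alpha\in\Gamma}V_\alpha$ is finite dimensional, $\Gamma_R=\{\alpha: V_\alpha\neq0\}$, $V_\pm=\bigoplus_{\alpha\in\Gamma^\pm}V_\alpha$,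 $M_\pm=\dim V_\pm$. $\mathfrak{gl}(V)=\mathrm{End}_{\mathbb C}(V)$ is graded by $\mathfrak{gl}(V)_\alpha=\bigoplus_\beta\mathrm{Hom}(V_\beta,V_{\alpha+\beta})$ with bracket $[X,Y]=XY-\omega(d(X),d(Y))YX$. A $\mathfrak{gl}(V)$-module is a $\Gamma$-graded vector space $M$ with a linear action satisfying $\mathfrak{gl}(V)_\alpha M_\beta\subset M_{\alpha+\beta}$ and $X(Yv)-\omega(d(X),d(Y))Y(Xv)=[X,Y]v$; all modules are $\Gamma$-graded. Fix a total order on $\Gamma_R$ which is distinguished: every element of $\Gamma_R\cap\Gamma^+$ precedes every element of $\Gamma_R\cap\Gamma^-$. Let $(b_1,\dots,b_{\dim V})$ be a basis of $V$ consisting of homogeneous elements, with degrees $\gamma_a=d(b_a)$ weakly increasing for this order (so $b_1,\dots,b_{M_+}$ is a basis of $V_+$). Let $E_{ab}$ be the matrix units, $E_{ab}b_c=\delta_{bc}b_a$; $\mathfrak h=\sum_a\mathbb CE_{aa}$, $\mathfrak n=\sum_{a<b}\mathbb CE_{ab}$, $\mathfrak b=\mathfrak h+\mathfrak n$. Let $\varepsilon_a\in\mathfrak h^*$, $\varepsilon_a(E_{bb})=\delta_{ab}$, and equip $\mathfrak h^*$ with the symmetric bilinear form $(\varepsilon_a,\varepsilon_b)=\omega(\gamma_a,\gamma_a)\delta_{ab}$. Put $\Phi_0^+=\{\varepsilon_a-\varepsilon_b: a<b\le M_+\}\cup\{\varepsilon_a-\varepsilon_b: M_+<a<b\}$. A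 highest weight module of highest weight $\lambda$ is a module generated by a nonzero homogeneous vector $v$ with $\mathfrak nv=0$ and $hv=\lambda(h)v$ for all $h\in\mathfrak h$. $L_\lambda$ is the simple one, unique up to isomorphism and shift of the $\Gamma$-grading. *)

theory Defs
  imports Complex_Main
begin

(* Vector spaces are given by an abelian group type together with a scalar multiplication
   satisfying the locale vector_space of HOL.Vector_Spaces; V is the whole type 'v, while
   gl(V)-modules are carried by subspaces of an arbitrary complex vector space 'm.
   The spans, dimensions etc. are those of that locale, with the scalar
   multiplication as explicit argument. *)

definition commutative_factor :: "('g::ab_group_add \<Rightarrow> 'g \<Rightarrow> complex) \<Rightarrow> bool" where
  "commutative_factor \<omega> \<longleftrightarrow>
     (\<forall>\<alpha> \<beta>. \<omega> \<alpha> \<beta> \<noteq> 0) \<and>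
     (\<forall>\<alpha> \<beta>. \<omega> \<alpha> \<beta> = inverse (\<omega> \<beta> \<alpha>)) \<and>
     (\<forall>\<alpha> \<beta> \<gamma>. \<omega> \<alpha> (\<beta> + \<gamma>) = \<omega> \<alpha> \<beta> * \<omega> \<alpha> \<gamma>) \<and>
     (\<forall>\<alpha> \<beta> \<gamma>. \<omega> (\<alpha> + \<beta>) \<gamma> = \<omega> \<alpha> \<gamma> * \<omega> \<beta> \<gamma>)"

definition Gamma_plus :: "('g::ab_group_add \<Rightarrow> 'g \<Rightarrow> complex) \<Rightarrow> 'g set" where
  "Gamma_plus \<omega> = {\<alpha>. \<omega> \<alpha> \<alpha> = 1}"

definition Gamma_minus :: "('g::ab_group_add \<Rightarrow> 'g \<Rightarrow> complex) \<Rightarrow> 'g set" where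
  "Gamma_minus \<omega> = {\<alpha>. \<omega> \<alpha> \<alpha> = -1}"

definition finite_dim :: "(complex \<Rightarrow> 'm \<Rightarrow> 'm::ab_group_add) \<Rightarrow> 'm set \<Rightarrow> bool" where
  "finite_dim scale W \<longleftrightarrow> (\<exists>B. finite B \<and> module.span scale B = W)"

(* W is the internal direct sum of the subspaces U \<alpha> *)
definition is_grading ::
  "(complex \<Rightarrow> 'm \<Rightarrow> 'm::ab_group_add) \<Rightarrow> ('g \<Rightarrow> 'm set) \<Rightarrow> 'm set \<Rightarrow> bool" where
  "is_grading scale U W \<longleftrightarrow>
     (\<forall>\<alpha>. module.subspace scale (U \<alpha>)) \<and>
     module.span scale (\<Union>\<alpha>. U \<alpha>) = W \<and>
     (\<forall>A x. finite A \<longrightarrow> (\<forall>\<alpha>\<in>A. x \<alpha> \<in> U \<alpha>) \<longrightarrow> (\<Sum>\<alpha>\<in>A. x \<alpha>) = 0 \<longrightarrow> (\<forall>\<alpha>\<in>A. x \<alpha> = 0))"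

definition Gamma_R :: "('g \<Rightarrow> 'v::ab_group_add set) \<Rightarrow> 'g set" where
  "Gamma_R V = {\<alpha>. V \<alpha> \<noteq> {0}}"

definition distinguished_order ::
  "('g::ab_group_add \<Rightarrow> 'g \<Rightarrow> complex) \<Rightarrow> ('g \<Rightarrow> 'v::ab_group_add set) \<Rightarrow> 'g rel \<Rightarrow> bool" where
  "distinguished_order \<omega> V r \<longleftrightarrow>
     linear_order_on (Gamma_R V) r \<and>
     (\<forall>\<alpha> \<in> Gamma_R V \<inter> Gamma_plus \<omega>. \<forall>\<beta> \<in> Gamma_R V \<inter> Gamma_minus \<omega>. (\<alpha>, \<beta>) \<in> r)"

definition dim_total :: "(complex \<Rightarrow> 'v \<Rightarrow> 'v::ab_group_add) \<Rightarrow> nat" where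
  "dim_total scale = vector_space.dim scale UNIV"

definition M_plus ::
  "('g::ab_group_add \<Rightarrow> 'g \<Rightarrow> complex) \<Rightarrow> (complex \<Rightarrow> 'v \<Rightarrow> 'v::ab_group_add) \<Rightarrow>
   ('g \<Rightarrow> 'v set) \<Rightarrow> nat" where
  "M_plus \<omega> scale V = vector_space.dim scale (module.span scale (\<Union>\<alpha>\<in>Gamma_plus \<omega>. V \<alpha>))"

definition homogeneous_basis ::
  "(complex \<Rightarrow> 'v \<Rightarrow> 'v::ab_group_add) \<Rightarrow> ('g \<Rightarrow> 'v set) \<Rightarrow> 'g rel \<Rightarrow>
   (nat \<Rightarrow> 'v) \<Rightarrow> (nat \<Rightarrow> 'g) \<Rightarrow> bool" where
  "homogeneous_basis scale V r b \<gamma> \<longleftrightarrow>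
     inj_on b {1..dim_total scale} \<and>
     \<not> module.dependent scale (b ` {1..dim_total scale}) \<and>
     module.span scale (b ` {1..dim_total scale}) = UNIV \<and>
     (\<forall>a \<in> {1..dim_total scale}. b a \<in> V (\<gamma> a)) \<and>
     (\<forall>a \<in> {1..dim_total scale}. \<forall>c \<in> {1..dim_total scale}. a \<le> c \<longrightarrow> (\<gamma> a, \<gamma> c) \<in> r)"

definition gl :: "(complex \<Rightarrow> 'v \<Rightarrow> 'v::ab_group_add) \<Rightarrow> ('v \<Rightarrow> 'v) set" where
  "gl scale = {X. Vector_Spaces.linear scale scale X}"

definition gl_deg ::
  "(complex \<Rightarrow> 'v \<Rightarrow> 'v::ab_group_add) \<Rightarrow> ('g::ab_group_add \<Rightarrow> 'v set) \<Rightarrow> 'g \<Rightarrow> ('v \<Rightarrow> 'v) set" where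
  "gl_deg scale V \<alpha> = {X \<in> gl scale. \<forall>\<beta>. X ` V \<beta> \<subseteq> V (\<alpha> + \<beta>)}"

(* The bracket of X and Y homogeneous of degrees \<alpha> and \<beta>; the module axioms below only
   use it on homogeneous elements, which determines its bilinear extension. *)
definition bracket ::
  "('g \<Rightarrow> 'g \<Rightarrow> complex) \<Rightarrow> (complex \<Rightarrow> 'v \<Rightarrow> 'v::ab_group_add) \<Rightarrow> 'g \<Rightarrow> 'g \<Rightarrow>
   ('v \<Rightarrow> 'v) \<Rightarrow> ('v \<Rightarrow> 'v) \<Rightarrow> 'v \<Rightarrow> 'v" where
  "bracket \<omega> scale \<alpha> \<beta> X Y = (\<lambda>v. X (Y v) - scale (\<omega> \<alpha> \<beta>) (Y (X v)))"

definition gl_module ::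
  "('g::ab_group_add \<Rightarrow> 'g \<Rightarrow> complex) \<Rightarrow>
   (complex \<Rightarrow> 'v \<Rightarrow> 'v::ab_group_add) \<Rightarrow> ('g \<Rightarrow> 'v set) \<Rightarrow>
   (complex \<Rightarrow> 'm \<Rightarrow> 'm::ab_group_add) \<Rightarrow> 'm set \<Rightarrow> ('g \<Rightarrow> 'm set) \<Rightarrow>
   (('v \<Rightarrow> 'v) \<Rightarrow> 'm \<Rightarrow> 'm) \<Rightarrow> bool" where
  "gl_module \<omega> scaleV V scaleM M Mgr act \<longleftrightarrow>
     module.subspace scaleM M \<and> is_grading scaleM Mgr M \<and>
     (\<forall>X \<in> gl scaleV. \<forall>m \<in> M. act X m \<in> M) \<and>
     (\<forall>X \<in> gl scaleV. \<forall>m \<in> M. \<forall>m' \<in> M. act X (m + m') = act X m + act X m') \<and>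
     (\<forall>X \<in> gl scaleV. \<forall>m \<in> M. \<forall>c. act X (scaleM c m) = scaleM c (act X m)) \<and>
     (\<forall>X \<in> gl scaleV. \<forall>Y \<in> gl scaleV. \<forall>m \<in> M. act (\<lambda>v. X v + Y v) m = act X m + act Y m) \<and>
     (\<forall>X \<in> gl scaleV. \<forall>m \<in> M. \<forall>c. act (\<lambda>v. scaleV c (X v)) m = scaleM c (act X m)) \<and>
     (\<forall>\<alpha> \<beta>. \<forall>X \<in> gl_deg scaleV V \<alpha>. \<forall>m \<in> Mgr \<beta>. act X m \<in> Mgr (\<alpha> + \<beta>)) \<and>
     (\<forall>\<alpha> \<beta>. \<forall>X \<in> gl_deg scaleV V \<alpha>. \<forall>Y \<in> gl_deg scaleV V \<beta>. \<forall>m \<in> M.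
        act X (act Y m) - scaleM (\<omega> \<alpha> \<beta>) (act Y (act X m)) = act (bracket \<omega> scaleV \<alpha> \<beta> X Y) m)"

definition gl_submodule ::
  "(complex \<Rightarrow> 'v \<Rightarrow> 'v::ab_group_add) \<Rightarrow>
   (complex \<Rightarrow> 'm \<Rightarrow> 'm::ab_group_add) \<Rightarrow> 'm set \<Rightarrow> ('g \<Rightarrow> 'm set) \<Rightarrow>
   (('v \<Rightarrow> 'v) \<Rightarrow> 'm \<Rightarrow> 'm) \<Rightarrow> 'm set \<Rightarrow> bool" where
  "gl_submodule scaleV scaleM M Mgr act W \<longleftrightarrow>
     W \<subseteq> M \<and> module.subspace scaleM W \<and> is_grading scaleM (\<lambda>\<alpha>. W \<inter> Mgr \<alpha>) W \<and>
     (\<forall>X \<in> gl scaleV. \<forall>w \<in> W. act X w \<in> W)"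

definition simple_gl_module ::
  "('g::ab_group_add \<Rightarrow> 'g \<Rightarrow> complex) \<Rightarrow>
   (complex \<Rightarrow> 'v \<Rightarrow> 'v::ab_group_add) \<Rightarrow> ('g \<Rightarrow> 'v set) \<Rightarrow>
   (complex \<Rightarrow> 'm \<Rightarrow> 'm::ab_group_add) \<Rightarrow> 'm set \<Rightarrow> ('g \<Rightarrow> 'm set) \<Rightarrow>
   (('v \<Rightarrow> 'v) \<Rightarrow> 'm \<Rightarrow> 'm) \<Rightarrow> bool" where
  "simple_gl_module \<omega> scaleV V scaleM M Mgr act \<longleftrightarrow>
     gl_module \<omega> scaleV V scaleM M Mgr act \<and> M \<noteq> {0} \<and>
     (\<forall>W. gl_submodule scaleV scaleM M Mgr act W \<longrightarrow> W = {0} \<or> W = M)"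

definition matrix_unit ::
  "(complex \<Rightarrow> 'v \<Rightarrow> 'v::ab_group_add) \<Rightarrow> (nat \<Rightarrow> 'v) \<Rightarrow> nat \<Rightarrow> nat \<Rightarrow> 'v \<Rightarrow> 'v" where
  "matrix_unit scale b a c =
     (\<lambda>v. scale (module.representation scale (b ` {1..dim_total scale}) v (b c)) (b a))"

definition cartan ::
  "(complex \<Rightarrow> 'v \<Rightarrow> 'v::ab_group_add) \<Rightarrow> (nat \<Rightarrow> 'v) \<Rightarrow> ('v \<Rightarrow> 'v) set" where
  "cartan scale b =
     {H. \<exists>c. H = (\<lambda>v. \<Sum>a\<in>{1..dim_total scale}. scale (c a) (matrix_unit scale b a a v))}"

definition nilradical ::
  "(complex \<Rightarrow> 'v \<Rightarrow> 'v::ab_group_add) \<Rightarrow> (nat \<Rightarrow> 'v) \<Rightarrow> ('v \<Rightarrow> 'v) set" where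
  "nilradical scale b =
     {X. \<exists>c. X = (\<lambda>v. \<Sum>(i, j)\<in>{(i, j). 1 \<le> i \<and> i < j \<and> j \<le> dim_total scale}.
                        scale (c i j) (matrix_unit scale b i j v))}"

(* Linear functionals on the Cartan subalgebra. They are HOL functions on all of 'v \<Rightarrow> 'v,
   but only their values on the Cartan subalgebra are constrained or used. *)
definition cartan_dual ::
  "(complex \<Rightarrow> 'v \<Rightarrow> 'v::ab_group_add) \<Rightarrow> (nat \<Rightarrow> 'v) \<Rightarrow> (('v \<Rightarrow> 'v) \<Rightarrow> complex) set" where
  "cartan_dual scale b =
     {l. (\<forall>H \<in> cartan scale b. \<forall>K \<in> cartan scale b. l (\<lambda>v. H v + K v) = l H + l K) \<and>
         (\<forall>H \<in> cartan scale b. \<forall>c. l (\<lambda>v. scale c (H v)) = c * l H)}"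

(* \<epsilon>_a reads off the a-th diagonal entry of the matrix with respect to b *)
definition eps ::
  "(complex \<Rightarrow> 'v \<Rightarrow> 'v::ab_group_add) \<Rightarrow> (nat \<Rightarrow> 'v) \<Rightarrow> nat \<Rightarrow> ('v \<Rightarrow> 'v) \<Rightarrow> complex" where
  "eps scale b a H = module.representation scale (b ` {1..dim_total scale}) (H (b a)) (b a)"

(* The bilinear form with (\<epsilon>_a, \<epsilon>_b) = \<omega>(\<gamma>_a, \<gamma>_a) \<delta>_ab:
   the \<epsilon>_a-coordinate of a functional is its value at E_aa. *)
definition weight_form ::
  "('g \<Rightarrow> 'g \<Rightarrow> complex) \<Rightarrow> (complex \<Rightarrow> 'v \<Rightarrow> 'v::ab_group_add) \<Rightarrow> (nat \<Rightarrow> 'v) \<Rightarrow> (nat \<Rightarrow> 'g) \<Rightarrow>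
   (('v \<Rightarrow> 'v) \<Rightarrow> complex) \<Rightarrow> (('v \<Rightarrow> 'v) \<Rightarrow> complex) \<Rightarrow> complex" where
  "weight_form \<omega> scale b \<gamma> l m =
     (\<Sum>a\<in>{1..dim_total scale}.
        \<omega> (\<gamma> a) (\<gamma> a) * l (matrix_unit scale b a a) * m (matrix_unit scale b a a))"

definition Phi0_plus ::
  "('g::ab_group_add \<Rightarrow> 'g \<Rightarrow> complex) \<Rightarrow> (complex \<Rightarrow> 'v \<Rightarrow> 'v::ab_group_add) \<Rightarrow>
   ('g \<Rightarrow> 'v set) \<Rightarrow> (nat \<Rightarrow> 'v) \<Rightarrow> (('v \<Rightarrow> 'v) \<Rightarrow> complex) set" where
  "Phi0_plus \<omega> scale V b =
     {(\<lambda>H. eps scale b a H - eps scale b c H) | a c.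
        1 \<le> a \<and> a < c \<and> c \<le> M_plus \<omega> scale V} \<union>
     {(\<lambda>H. eps scale b a H - eps scale b c H) | a c.
        M_plus \<omega> scale V < a \<and> a < c \<and> c \<le> dim_total scale}"

(* \<nat>, here a subset of the complex numbers, contains 0 *)
definition Lambda_dom ::
  "('g::ab_group_add \<Rightarrow> 'g \<Rightarrow> complex) \<Rightarrow> (complex \<Rightarrow> 'v \<Rightarrow> 'v::ab_group_add) \<Rightarrow>
   ('g \<Rightarrow> 'v set) \<Rightarrow> (nat \<Rightarrow> 'v) \<Rightarrow> (nat \<Rightarrow> 'g) \<Rightarrow> (('v \<Rightarrow> 'v) \<Rightarrow> complex) set" where
  "Lambda_dom \<omega> scale V b \<gamma> =
     {l \<in> cartan_dual scale b. \<forall>\<Upsilon> \<in> Phi0_plus \<omega> scale V b.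
        2 * weight_form \<omega> scale b \<gamma> l \<Upsilon> / weight_form \<omega> scale b \<gamma> \<Upsilon> \<Upsilon> \<in> \<nat>}"

definition highest_weight_module ::
  "('g::ab_group_add \<Rightarrow> 'g \<Rightarrow> complex) \<Rightarrow>
   (complex \<Rightarrow> 'v \<Rightarrow> 'v::ab_group_add) \<Rightarrow> ('g \<Rightarrow> 'v set) \<Rightarrow> (nat \<Rightarrow> 'v) \<Rightarrow>
   (complex \<Rightarrow> 'm \<Rightarrow> 'm::ab_group_add) \<Rightarrow> 'm set \<Rightarrow> ('g \<Rightarrow> 'm set) \<Rightarrow>
   (('v \<Rightarrow> 'v) \<Rightarrow> 'm \<Rightarrow> 'm) \<Rightarrow> (('v \<Rightarrow> 'v) \<Rightarrow> complex) \<Rightarrow> bool" where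
  "highest_weight_module \<omega> scaleV V b scaleM M Mgr act l \<longleftrightarrow>
     gl_module \<omega> scaleV V scaleM M Mgr act \<and>
     (\<exists>\<mu>. \<exists>v \<in> Mgr \<mu>. v \<noteq> 0 \<and>
        (\<forall>X \<in> nilradical scaleV b. act X v = 0) \<and>
        (\<forall>H \<in> cartan scaleV b. act H v = scaleM (l H) v) \<and>
        \<Inter>{W. gl_submodule scaleV scaleM M Mgr act W \<and> v \<in> W} = M)"

(* M is a realisation of the simple highest weight module L_l of highest weight l; L_l being
   unique up to isomorphism and shift of the grading, assertions about it are assertions
   about all its realisations. *)
definition is_L ::
  "('g::ab_group_add \<Rightarrow> 'g \<Rightarrow> complex) \<Rightarrow>
   (complex \<Rightarrow> 'v \<Rightarrow> 'v::ab_group_add) \<Rightarrow> ('g \<Rightarrow> 'v set) \<Rightarrow> (nat \<Rightarrow> 'v) \<Rightarrow>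
   (complex \<Rightarrow> 'm \<Rightarrow> 'm::ab_group_add) \<Rightarrow> 'm set \<Rightarrow> ('g \<Rightarrow> 'm set) \<Rightarrow>
   (('v \<Rightarrow> 'v) \<Rightarrow> 'm \<Rightarrow> 'm) \<Rightarrow> (('v \<Rightarrow> 'v) \<Rightarrow> complex) \<Rightarrow> bool" where
  "is_L \<omega> scaleV V b scaleM M Mgr act l \<longleftrightarrow>
     simple_gl_module \<omega> scaleV V scaleM M Mgr act \<and>
     highest_weight_module \<omega> scaleV V b scaleM M Mgr act l"

end

theory Submission
  imports Defs "HOL-Computational_Algebra.Fundamental_Theorem_Algebra"
begin

text \<open>In a finite dimensional simple module, a homogeneous common eigenvector of the Cartan subalgebra
  on which \<open>-\<Sum>\<^sub>a a E\<^sub>a\<^sub>a\<close> has an eigenvalue of maximal real part is annihilated by all raising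
  operators. For a root within one parity block the colour factors drop out of the
  \<open>sl\<^sub>2\<close> relations, so finite dimensionality forces dominance on the even part.

  Conversely, let the highest weight \<open>\<lambda>\<close> be dominant and let \<open>m = \<lambda>\<^sub>a - \<lambda>\<^bsub>a+1\<^esub>\<close> for an even simple root.
  Then \<open>E\<^bsub>a+1,a\<^esub>\<^bsup>m+1\<^esup> v\<close> is again a highest weight vector, of strictly smaller height, hence zero. In a
  simple module a root vector that is nilpotent on one nonzero homogeneous vector is locally
  nilpotent, and if \<open>x\<close> and \<open>y\<close> are locally nilpotent and commute with \<open>[x, y]\<close> up to scalars, then \<open>[x, y]\<close>
  is locally nilpotent. So all even lowering operators are locally nilpotent; the odd ones square to
  zero. Adding them one at a time in order of decreasing height to the line through \<open>v\<close>
  gives a finite dimensional subspace stable under all lowering operators, which is the whole module.\<close>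

section \<open>Operators on a subspace and their eigenvectors\<close>

text \<open>Linearity is asked for on \<open>M\<close> alone because the module axioms say nothing
  about the action outside the module.\<close>

locale subspace_operator = vector_space scale
  for scale :: "complex \<Rightarrow> 'm::ab_group_add \<Rightarrow> 'm" (infixr "*s" 75) +
  fixes M :: "'m set" and T :: "'m \<Rightarrow> 'm"
  assumes M_subspace: "subspace M"
    and T_closed: "u \<in> M \<Longrightarrow> T u \<in> M"
    and T_add: "u \<in> M \<Longrightarrow> w \<in> M \<Longrightarrow> T (u + w) = T u + T w"
    and T_scale: "u \<in> M \<Longrightarrow> T (k *s u) = k *s T u"
begin

lemma T_zero: "T 0 = 0"
  using T_scale[of 0 0] M_subspace by (simp add: subspace_0)

lemma T_sum:
  assumes "finite F" "\<And>i. i \<in> F \<Longrightarrow> f i \<in> M"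
  shows "T (sum f F) = (\<Sum>i\<in>F. T (f i))"
  using assms by (induction F) (auto simp: T_zero T_add subspace_sum[OF M_subspace])

lemma pow_closed: "u \<in> M \<Longrightarrow> (T ^^ k) u \<in> M"
  by (induction k) (auto intro: T_closed)

lemma pow_zero: "(T ^^ k) 0 = 0"
  by (induction k) (auto simp: T_zero)

lemma pow_add: "u \<in> M \<Longrightarrow> w \<in> M \<Longrightarrow> (T ^^ k) (u + w) = (T ^^ k) u + (T ^^ k) w"
  by (induction k) (auto simp: T_add pow_closed)

lemma pow_scale: "u \<in> M \<Longrightarrow> (T ^^ k) (a *s u) = a *s (T ^^ k) u"
  by (induction k) (auto simp: T_scale pow_closed)

lemma pow_eq_0_mono:
  assumes "(T ^^ k) u = 0" "k \<le> j"
  shows "(T ^^ j) u = 0"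
proof -
  have "(T ^^ (j - k + k)) u = (T ^^ (j - k)) ((T ^^ k) u)"
    by (simp only: funpow_add o_apply)
  then show ?thesis using assms by (simp add: pow_zero)
qed

text \<open>Used to reach the end of an \<open>sl_2\<close> string and to find a nonzero vector
  killed by a locally nilpotent operator.\<close>

lemma last_nonzero_power:
  assumes "(T ^^ k) u = 0" "u \<noteq> 0"
  obtains j where "(T ^^ j) u \<noteq> 0" "T ((T ^^ j) u) = 0"
proof -
  define j where "j = (LEAST j. (T ^^ j) u = 0)"
  have j: "(T ^^ j) u = 0" unfolding j_def by (rule LeastI) (rule assms)
  then obtain i where i: "j = Suc i" using assms(2) by (cases j) auto
  have "(T ^^ i) u \<noteq> 0" using not_less_Least[of i "\<lambda>j. (T ^^ j) u = 0"] i j_def by auto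
  then show thesis using that j i by simp
qed

lemma T_span:
  assumes "B \<subseteq> M" "\<And>u. u \<in> B \<Longrightarrow> T u \<in> span C" "u \<in> span B"
  shows "T u \<in> span C"
proof -
  \<comment> \<open>Membership in \<open>M\<close> is carried through the induction, since
    additivity of \<open>T\<close> is available only there.\<close>
  have "u \<in> M \<and> T u \<in> span C"
    using assms(3)
  proof (induction rule: span_induct_alt)
    case base then show ?case using M_subspace by (simp add: T_zero span_zero subspace_0)
  next
    case (step c x y)
    then have "x \<in> M" "y \<in> M" using assms(1) by auto
    then have "T (c *s x + y) = c *s T x + T y" "c *s x + y \<in> M"
      using M_subspace by (simp_all add: T_add T_scale subspace_scale subspace_add)
    then show ?case using step assms(2) by (simp add: span_add span_scale)
  qed
  then show ?thesis ..
qed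

text \<open>The operator \<open>T - g x\<close> removes the summand at \<open>x\<close>, rescales
  the others by \<open>g t - g x\<close>, and multiplies \<open>u\<close> by the nonzero number
  \<open>c - g x\<close>. Several \<open>t\<close> may share an eigenvalue.\<close>

lemma eigenvalues_eq_of_sum:
  assumes "finite F" "\<And>t. t \<in> F \<Longrightarrow> t \<in> M \<and> T t = g t *s t \<and> g t \<noteq> c"
    "T u = c *s u" "u = (\<Sum>t\<in>F. r t *s t)"
  shows "u = 0"
  using assms
proof (induction F arbitrary: u r)
  case (insert x F)
  let ?y = "\<Sum>t\<in>F. (r t * (g t - g x)) *s t"
  have MF: "\<And>t. t \<in> insert x F \<Longrightarrow> r t *s t \<in> M"
    using insert.prems(1) M_subspace by (auto simp: subspace_scale)
  have uM: "u \<in> M" using insert.prems(3) MF M_subspace by (auto intro!: subspace_sum)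
  have "T u = (\<Sum>t\<in>insert x F. r t *s g t *s t)"
    unfolding insert.prems(3) using MF insert.hyps insert.prems(1)
    by (subst T_sum) (auto simp: T_scale intro!: sum.cong)
  then have "T u - g x *s u = (\<Sum>t\<in>insert x F. r t *s g t *s t - g x *s r t *s t)"
    unfolding insert.prems(3) by (simp only: scale_sum_right sum_subtractf)
  also have "\<dots> = (\<Sum>t\<in>insert x F. (r t * (g t - g x)) *s t)"
    by (intro sum.cong refl) (simp add: scale_left_diff_distrib algebra_simps)
  also have "\<dots> = ?y" using insert.hyps by simp
  finally have y: "(c - g x) *s u = ?y"
    using insert.prems(2) by (simp add: scale_left_diff_distrib)
  have "T ((c - g x) *s u) = c *s (c - g x) *s u"
    using uM insert.prems(2) by (simp add: T_scale mult.commute)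
  with insert.IH[of "(c - g x) *s u" "\<lambda>t. r t * (g t - g x)"] insert.prems(1) y
  have "(c - g x) *s u = 0" by auto
  then show ?case using insert.prems(1)[of x] by auto
qed auto

lemma eigenvector_in_span:
  assumes "\<And>t. t \<in> E \<Longrightarrow> t \<in> M \<and> (\<exists>d. T t = d *s t \<and> d \<noteq> c)" "T u = c *s u" "u \<in> span E"
  shows "u = 0"
proof -
  obtain F r where F: "finite F" "F \<subseteq> E" "u = (\<Sum>t\<in>F. r t *s t)"
    using assms(3) unfolding span_explicit by auto
  obtain g where "\<And>t. t \<in> E \<Longrightarrow> T t = g t *s t \<and> g t \<noteq> c" using assms(1) by metis
  then show ?thesis using eigenvalues_eq_of_sum[of F g c u r] F assms by blast
qed

text \<open>Eigenvectors with distinct eigenvalues are independent, so there are at most as many as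
  elements of \<open>B\<close>.\<close>

lemma finite_eigenvectors:
  assumes "finite B" "M \<subseteq> span B"
    and E: "\<And>t. t \<in> E \<Longrightarrow> t \<in> M \<and> t \<noteq> 0 \<and> T t = g t *s t" and "inj_on g E"
  shows "finite E"
proof -
  have "independent E"
  proof
    assume "dependent E"
    then obtain a where a: "a \<in> E" "a \<in> span (E - {a})" unfolding dependent_def by blast
    have "a = 0"
    proof (rule eigenvector_in_span[of "E - {a}" "g a"])
      fix t assume t: "t \<in> E - {a}"
      then have "g t \<noteq> g a" using assms(4) a(1) by (auto simp: inj_on_def)
      then show "t \<in> M \<and> (\<exists>d. T t = d *s t \<and> d \<noteq> g a)" using E t by blast
    qed (use E a in auto)
    then show False using E a by auto
  qed
  then show ?thesis using independent_span_bound[OF assms(1)] E assms(2) by blast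
qed

text \<open>One eigenvector is chosen per eigenvalue; a nonzero vector determines its eigenvalue, so
  the choice is injective.\<close>

lemma finite_eigenvalues:
  assumes "finite B" "M \<subseteq> span B"
  shows "finite {c. \<exists>u\<in>M. u \<noteq> 0 \<and> T u = c *s u}" (is "finite ?C")
proof -
  have "\<forall>c\<in>?C. \<exists>u. u \<in> M \<and> u \<noteq> 0 \<and> T u = c *s u" by blast
  from bchoice[OF this] obtain h where "\<forall>c\<in>?C. h c \<in> M \<and> h c \<noteq> 0 \<and> T (h c) = c *s h c" ..
  note h = bspec[OF this]
  have inj: "inj_on h ?C"
  proof (rule inj_onI)
    fix c d assume c: "c \<in> ?C" and d: "d \<in> ?C" and eq: "h c = h d"
    have "c *s h c = d *s h c" unfolding h[OF c, THEN conjunct2, THEN conjunct2, symmetric]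
      unfolding eq h[OF d, THEN conjunct2, THEN conjunct2] ..
    then show "c = d" unfolding scale_cancel_right using h[OF c, THEN conjunct2, THEN conjunct1] by argo
  qed
  have "finite (h ` ?C)"
  proof (rule finite_eigenvectors[OF assms])
    fix t assume "t \<in> h ` ?C"
    then obtain c where c: "c \<in> ?C" "t = h c" by (rule imageE)
    show "t \<in> M \<and> t \<noteq> 0 \<and> T t = inv_into ?C h t *s t"
      unfolding c(2) inv_into_f_f[OF inj c(1)] by (rule h[OF c(1)])
  qed (rule inj_on_inv_into[OF order_refl])
  then show ?thesis using inj finite_imageD by blast
qed

text \<open>This is \<open>p(T) w\<close>, computed by Horner's scheme. Evaluating at a vector
  avoids an operator algebra for maps that are linear only on \<open>M\<close>.\<close>

definition poly_apply :: "complex poly \<Rightarrow> 'm \<Rightarrow> 'm" where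
  "poly_apply p w = fold_coeffs (\<lambda>a u. a *s w + T u) p 0"

lemma poly_apply_0 [simp]: "poly_apply 0 w = 0"
  by (simp add: poly_apply_def)

lemma poly_apply_pCons [simp]: "poly_apply (pCons a p) w = a *s w + T (poly_apply p w)"
proof (cases "a = 0 \<and> p = 0")
  case True
  then show ?thesis by (simp add: T_zero)
next
  case False
  then show ?thesis by (cases "a = 0") (auto simp: poly_apply_def)
qed

lemma poly_apply_closed: "w \<in> M \<Longrightarrow> poly_apply p w \<in> M"
  using M_subspace
  by (induct p) (auto simp: subspace_0 intro!: subspace_add subspace_scale T_closed)

lemma poly_apply_add:
  assumes "w \<in> M"
  shows "poly_apply (p + q) w = poly_apply p w + poly_apply q w"
  by (induct p q rule: poly_induct2)
     (simp_all add: assms T_add poly_apply_closed scale_left_distrib)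

lemma poly_apply_smult:
  assumes "w \<in> M"
  shows "poly_apply (smult a p) w = a *s poly_apply p w"
  by (induct p) (simp_all add: assms T_scale poly_apply_closed scale_right_distrib)

lemma poly_apply_monom: "w \<in> M \<Longrightarrow> poly_apply (monom a k) w = a *s (T ^^ k) w"
  by (induction k) (simp_all add: monom_0 T_zero monom_Suc T_scale pow_closed)

lemma poly_apply_sum:
  assumes "w \<in> M" "finite F"
  shows "poly_apply (sum f F) w = (\<Sum>i\<in>F. poly_apply (f i) w)"
  using assms(2) by (induction F) (auto simp: poly_apply_add assms(1))

text \<open>Otherwise the powers \<open>T^k w\<close> would form an infinite independent subset of a
  finitely spanned space.\<close>

lemma annihilating_poly:
  assumes "finite B" "M \<subseteq> span B" "w \<in> M"
  shows "\<exists>p. p \<noteq> 0 \<and> poly_apply p w = 0"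
proof (rule ccontr)
  assume "\<not> ?thesis"
  then have nz: "\<And>p. poly_apply p w = 0 \<Longrightarrow> p = 0" by blast
  let ?f = "\<lambda>k. (T ^^ k) w"
  \<comment> \<open>Independence is a property of sets, so coincidences among the powers have to be
    excluded separately.\<close>
  have inj: "inj ?f"
  proof (rule injI, rule ccontr)
    fix i j assume ij: "?f i = ?f j" "i \<noteq> j"
    have "monom 1 i + smult (-1) (monom 1 j) = (0 :: complex poly)"
      using ij by (intro nz)
        (simp add: poly_apply_add poly_apply_smult poly_apply_monom assms del: smult_minus_left)
    then have "monom 1 i = (monom 1 j :: complex poly)" by simp
    then have "coeff (monom 1 i) i = (coeff (monom 1 j) i :: complex)" by simp
    then show False using ij by simp
  qed
  have "independent (range ?f)"
    unfolding independent_explicit_module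
  proof (intro allI impI)
    fix t r v assume t: "finite t" "t \<subseteq> range ?f" "(\<Sum>v\<in>t. r v *s v) = 0" "v \<in> t"
    then obtain k where k: "v = ?f k" by blast
    define K where "K = ?f -` t"
    have K: "finite K" "t = ?f ` K" "k \<in> K"
      using t k inj unfolding K_def by (auto intro: finite_vimageI)
    let ?p = "\<Sum>i\<in>K. monom (r (?f i)) i"
    have "poly_apply ?p w = (\<Sum>i\<in>K. r (?f i) *s ?f i)"
      using assms(3) K(1) by (simp add: poly_apply_sum poly_apply_monom)
    also have "\<dots> = (\<Sum>v\<in>t. r v *s v)"
      unfolding K(2) by (subst sum.reindex) (auto intro: inj_on_subset[OF inj])
    finally have "?p = 0" using t by (intro nz) simp
    then have "coeff ?p k = 0" by simp
    then show "r v = 0" using K k by (simp add: coeff_sum sum.delta)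
  qed
  then have "finite (range ?f)"
    using independent_span_bound[OF assms(1)] assms(2) pow_closed[OF assms(3)] by blast
  then show False using inj finite_imageD by blast
qed

text \<open>A polynomial of least degree annihilating \<open>w\<close> has a factor
  \<open>X - c\<close>; the cofactor applied to \<open>w\<close> is nonzero by minimality and is an
  eigenvector for \<open>c\<close>.\<close>

lemma eigenvector_exists:
  assumes "finite B" "M \<subseteq> span B" "M \<noteq> {0}"
  shows "\<exists>u\<in>M. \<exists>c. u \<noteq> 0 \<and> T u = c *s u"
proof -
  obtain w where w: "w \<in> M" "w \<noteq> 0" using assms(3) M_subspace subspace_0 by blast
  obtain p where p: "p \<noteq> 0" "poly_apply p w = 0"
    and least: "\<And>q. q \<noteq> 0 \<Longrightarrow> poly_apply q w = 0 \<Longrightarrow> degree p \<le> degree q"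
    using ex_has_least_nat[of "\<lambda>p. p \<noteq> 0 \<and> poly_apply p w = 0" _ degree]
      annihilating_poly[OF assms(1,2) w(1)] by metis
  \<comment> \<open>Only nonzero constants have no root, and these do not annihilate
    \<open>w\<close>.\<close>
  have "\<not> (\<exists>a l. a \<noteq> 0 \<and> l = 0 \<and> p = pCons a l)" using p w by (auto simp: T_zero)
  then obtain c where "poly p c = 0" using fundamental_theorem_of_algebra_alt by blast
  then obtain q where q: "p = [:-c, 1:] * q" by (auto simp: poly_eq_0_iff_dvd)
  with p have "q \<noteq> 0" by auto
  then have "degree q < degree p" unfolding q by (subst degree_mult_eq) auto
  with \<open>q \<noteq> 0\<close> least have nz: "poly_apply q w \<noteq> 0" using not_less by blast
  have "p = smult (-c) q + pCons 0 q" unfolding q by simp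
  then have "poly_apply p w = (-c) *s poly_apply q w + T (poly_apply q w)"
    using w by (simp add: poly_apply_add poly_apply_smult del: smult_minus_left)
  with p nz show ?thesis
    by (intro bexI[of _ "poly_apply q w"] exI[of _ c])
       (auto simp: poly_apply_closed[OF w(1)] eq_neg_iff_add_eq_0 add.commute)
qed

end

section \<open>Simple modules in terms of matrix units\<close>

lemma is_grading_subset: "vector_space scale \<Longrightarrow> is_grading scale U W \<Longrightarrow> U \<alpha> \<subseteq> W"
  unfolding is_grading_def
  using module.span_superset[of scale "\<Union>\<alpha>. U \<alpha>"] module_iff_vector_space[of scale] by blast

lemma is_grading_subspaceD: "is_grading scale U W \<Longrightarrow> module.subspace scale (U \<alpha>)"
  unfolding is_grading_def by (elim conjE) (erule spec)

lemma is_grading_sum_zeroD: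
  "is_grading scale U W \<Longrightarrow> finite A \<Longrightarrow> \<forall>\<alpha>\<in>A. x \<alpha> \<in> U \<alpha> \<Longrightarrow> sum x A = 0 \<Longrightarrow> \<forall>\<alpha>\<in>A. x \<alpha> = 0"
  unfolding is_grading_def by (elim conjE) (drule spec[of _ A], drule spec[of _ x], drule (1) mp, drule (1) mp, erule (1) mp)

section \<open>Identities for commutative factors\<close>

context
  fixes \<omega> :: "'g::ab_group_add \<Rightarrow> 'g \<Rightarrow> complex"
  assumes omega: "commutative_factor \<omega>"
begin

lemma cf_nonzero: "\<omega> \<alpha> \<beta> \<noteq> 0"
  and cf_swap: "\<omega> \<alpha> \<beta> = inverse (\<omega> \<beta> \<alpha>)"
  and cf_add_right: "\<omega> \<alpha> (\<beta> + \<delta>) = \<omega> \<alpha> \<beta> * \<omega> \<alpha> \<delta>"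
  and cf_add_left: "\<omega> (\<alpha> + \<beta>) \<delta> = \<omega> \<alpha> \<delta> * \<omega> \<beta> \<delta>"
  using omega unfolding commutative_factor_def by blast+

lemma cf_diff_left: "\<omega> (\<alpha> - \<beta>) \<delta> = \<omega> \<alpha> \<delta> / \<omega> \<beta> \<delta>"
  using cf_add_left[of "\<alpha> - \<beta>" \<beta> \<delta>] cf_nonzero by simp

lemma cf_diff_right: "\<omega> \<alpha> (\<beta> - \<delta>) = \<omega> \<alpha> \<beta> / \<omega> \<alpha> \<delta>"
  using cf_add_right[of \<alpha> "\<beta> - \<delta>" \<delta>] cf_nonzero by simp

lemma cf_zero_left: "\<omega> 0 \<beta> = 1"
  using cf_diff_left[of 0 0 \<beta>] cf_nonzero by simp

lemma cf_self_square: "\<omega> \<alpha> \<alpha> * \<omega> \<alpha> \<alpha> = 1"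
  using cf_swap[of \<alpha> \<alpha>] cf_nonzero[of \<alpha> \<alpha>] by (metis left_inverse)

lemma cf_self: "\<omega> \<alpha> \<alpha> = 1 \<or> \<omega> \<alpha> \<alpha> = -1"
  using cf_self_square square_eq_1_iff by blast

text \<open>Degrees of matrix units are differences, so the parity sign of \<open>E_ac\<close> is
  the product of the signs of its two indices.\<close>

lemma cf_self_diff: "\<omega> (\<alpha> - \<beta>) (\<alpha> - \<beta>) = \<omega> \<alpha> \<alpha> * \<omega> \<beta> \<beta>"
  using cf_self[of \<alpha>] cf_self[of \<beta>] cf_nonzero
  by (auto simp: cf_diff_left cf_diff_right cf_swap[of \<beta> \<alpha>])

text \<open>Opposite root vectors have opposite degrees; for indices of equal parity their bracket
  is therefore an ordinary commutator.\<close>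

lemma cf_diff_swap: "\<omega> (\<alpha> - \<beta>) (\<beta> - \<alpha>) = \<omega> \<alpha> \<alpha> * \<omega> \<beta> \<beta>"
  using cf_self[of \<alpha>] cf_self[of \<beta>] cf_nonzero
  by (auto simp: cf_diff_left cf_diff_right cf_swap[of \<beta> \<alpha>])

end

text \<open>A simple module as seen by the matrix units: \<open>e a c\<close> stands for the action
  of \<open>E_ac\<close>, and \<open>e_bracket\<close> writes out the bracket of \<open>E_ac\<close>
  and \<open>E_pq\<close>. The distinguished order enters through
  \<open>parity_mono\<close>.\<close>

locale simple_color_module = vector_space scale
  for scale :: "complex \<Rightarrow> 'm::ab_group_add \<Rightarrow> 'm" (infixr "*s" 75) +
  fixes \<omega> :: "'g::ab_group_add \<Rightarrow> 'g \<Rightarrow> complex"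
    and \<gamma> :: "nat \<Rightarrow> 'g" and n :: nat
    and M :: "'m set" and Mgr :: "'g \<Rightarrow> 'm set"
    and e :: "nat \<Rightarrow> nat \<Rightarrow> 'm \<Rightarrow> 'm"
  assumes omega: "commutative_factor \<omega>"
    and parity_mono: "\<lbrakk>a \<in> {1..n}; c \<in> {1..n}; a \<le> c; \<omega> (\<gamma> c) (\<gamma> c) = 1\<rbrakk> \<Longrightarrow> \<omega> (\<gamma> a) (\<gamma> a) = 1"
    and M_subspace: "subspace M"
    and grading: "is_grading scale Mgr M"
    and e_closed: "\<lbrakk>a \<in> {1..n}; c \<in> {1..n}; u \<in> M\<rbrakk> \<Longrightarrow> e a c u \<in> M"
    and e_add: "\<lbrakk>a \<in> {1..n}; c \<in> {1..n}; u \<in> M; w \<in> M\<rbrakk> \<Longrightarrow> e a c (u + w) = e a c u + e a c w"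
    and e_scale: "\<lbrakk>a \<in> {1..n}; c \<in> {1..n}; u \<in> M\<rbrakk> \<Longrightarrow> e a c (k *s u) = k *s e a c u"
    and e_degree: "\<lbrakk>a \<in> {1..n}; c \<in> {1..n}; u \<in> Mgr \<beta>\<rbrakk> \<Longrightarrow> e a c u \<in> Mgr (\<gamma> a - \<gamma> c + \<beta>)"
    and e_bracket: "\<lbrakk>a \<in> {1..n}; c \<in> {1..n}; p \<in> {1..n}; q \<in> {1..n}; u \<in> M\<rbrakk> \<Longrightarrow>
      e a c (e p q u) = \<omega> (\<gamma> a - \<gamma> c) (\<gamma> p - \<gamma> q) *s e p q (e a c u) +
        ((if c = p then e a q u else 0) -
         (if q = a then \<omega> (\<gamma> a - \<gamma> c) (\<gamma> p - \<gamma> q) *s e p c u else 0))"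
    and nontrivial: "M \<noteq> {0}"
    and simple: "\<lbrakk>W \<subseteq> M; subspace W; is_grading scale (\<lambda>\<alpha>. W \<inter> Mgr \<alpha>) W;
        \<And>a c u. \<lbrakk>a \<in> {1..n}; c \<in> {1..n}; u \<in> W\<rbrakk> \<Longrightarrow> e a c u \<in> W\<rbrakk> \<Longrightarrow> W = {0} \<or> W = M"
begin

lemma operator_e: "a \<in> {1..n} \<Longrightarrow> c \<in> {1..n} \<Longrightarrow> subspace_operator scale M (e a c)"
  by unfold_locales (auto simp: M_subspace intro: e_closed e_add e_scale)

definition homog :: "'m \<Rightarrow> bool" where "homog u \<longleftrightarrow> (\<exists>\<mu>. u \<in> Mgr \<mu>)"

lemma homog_in_M: "homog u \<Longrightarrow> u \<in> M"
  unfolding homog_def using is_grading_subset[OF vector_space_axioms grading] by blast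

lemma homog_e: "a \<in> {1..n} \<Longrightarrow> c \<in> {1..n} \<Longrightarrow> homog u \<Longrightarrow> homog (e a c u)"
  unfolding homog_def using e_degree by blast

lemma homog_pow: "a \<in> {1..n} \<Longrightarrow> c \<in> {1..n} \<Longrightarrow> homog u \<Longrightarrow> homog ((e a c ^^ k) u)"
  by (induction k) (auto intro: homog_e)

lemma homog_nonzero_exists: obtains u where "homog u" "u \<noteq> 0"
proof -
  have "\<exists>u. homog u \<and> u \<noteq> 0"
  proof (rule ccontr)
    assume "\<not> ?thesis"
    then have "(\<Union>\<alpha>. Mgr \<alpha>) \<subseteq> {0}" unfolding homog_def by auto
    then have "M \<subseteq> {0}" using grading unfolding is_grading_def by (metis span_minimal subspace_single_0)
    then show False using nontrivial M_subspace subspace_0 by blast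
  qed
  then show thesis using that by blast
qed

text \<open>Each generator lies in one of the intersections with \<open>Mgr\<close>, and directness
  is inherited. This opens spans of homogeneous vectors to the simplicity argument.\<close>

lemma grading_span_homog:
  assumes "\<And>u. u \<in> E \<Longrightarrow> homog u"
  shows "is_grading scale (\<lambda>\<alpha>. span E \<inter> Mgr \<alpha>) (span E)"
  unfolding is_grading_def
proof (intro conjI allI impI)
  show "subspace (span E \<inter> Mgr \<alpha>)" for \<alpha>
    using grading unfolding is_grading_def by (intro subspace_inter) auto
  show "span (\<Union>\<alpha>. span E \<inter> Mgr \<alpha>) = span E"
  proof
    show "span (\<Union>\<alpha>. span E \<inter> Mgr \<alpha>) \<subseteq> span E"
      by (rule span_minimal[OF _ subspace_span]) blast
    have "u \<in> (\<Union>\<alpha>. span E \<inter> Mgr \<alpha>)" if "u \<in> E" for u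
      using assms[OF that] span_base[OF that] unfolding homog_def by blast
    then show "span E \<subseteq> span (\<Union>\<alpha>. span E \<inter> Mgr \<alpha>)"
      by (intro span_mono subsetI)
  qed
  show "\<forall>\<alpha>\<in>A. x \<alpha> = 0" if "finite A" "\<forall>\<alpha>\<in>A. x \<alpha> \<in> span E \<inter> Mgr \<alpha>" "sum x A = 0" for A x
    by (rule is_grading_sum_zeroD[OF grading that(1) _ that(3)]) (use that(2) in simp)
qed

text \<open>Monomials in the matrix units from \<open>P\<close>, applied to \<open>w\<close>. All
  index pairs yield the submodule generated by \<open>w\<close>; the lowering pairs yield the
  analogue of \<open>U(n^-) w\<close>.\<close>

inductive_set words :: "(nat \<times> nat) set \<Rightarrow> 'm \<Rightarrow> 'm set" for P w where
  words_base: "w \<in> words P w"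
| words_step: "x \<in> words P w \<Longrightarrow> (a, c) \<in> P \<Longrightarrow> e a c x \<in> words P w"

lemma words_homog:
  assumes "P \<subseteq> {1..n} \<times> {1..n}" "homog w" "x \<in> words P w"
  shows "homog x"
  using assms(3)
proof induction
  case (words_step x a c)
  then show ?case using assms(1) homog_e by blast
qed (rule assms(2))

lemma span_words_stable:
  assumes "P \<subseteq> {1..n} \<times> {1..n}" "homog w" "(a, c) \<in> P" "u \<in> span (words P w)"
  shows "e a c u \<in> span (words P w)"
proof -
  interpret subspace_operator scale M "e a c" using assms by (intro operator_e) auto
  show ?thesis
    by (rule T_span[OF _ _ assms(4)])
       (use assms(3) words_homog[OF assms(1,2)] in \<open>auto intro: homog_in_M words_step span_base\<close>)
qed

text \<open>The span is graded, stable and nonzero, so simplicity leaves only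
  \<open>M\<close>.\<close>

lemma span_words_all:
  assumes "homog w" "w \<noteq> 0"
  shows "span (words ({1..n} \<times> {1..n}) w) = M"
proof -
  let ?W = "words ({1..n} \<times> {1..n}) w"
  have h: "\<And>x. x \<in> ?W \<Longrightarrow> homog x" using words_homog assms by blast
  have "span ?W = {0} \<or> span ?W = M"
  proof (rule simple)
    show "span ?W \<subseteq> M" using h homog_in_M by (intro span_minimal[OF _ M_subspace]) auto
  qed (use grading_span_homog h span_words_stable[OF _ assms(1)] in auto)
  moreover have "w \<in> span ?W" by (intro span_base words_base)
  ultimately show ?thesis using assms by auto
qed

subsection \<open>Local nilpotency\<close>

text \<open>Simplicity makes local nilpotency of a root vector on a single nonzero homogeneous vector
  a global property.\<close>

definition nil :: "nat \<Rightarrow> nat \<Rightarrow> 'm \<Rightarrow> bool" where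
  "nil a c u \<longleftrightarrow> (\<exists>k. (e a c ^^ k) u = 0)"

lemma nil_e:
  assumes "a \<in> {1..n}" "c \<in> {1..n}" "nil a c u"
  shows "nil a c (e a c u)"
proof -
  interpret subspace_operator scale M "e a c" by (rule operator_e) fact+
  obtain k where "(e a c ^^ k) u = 0" using assms(3) unfolding nil_def by blast
  then have "(e a c ^^ k) (e a c u) = 0" by (simp add: funpow_swap1[symmetric] T_zero)
  then show ?thesis unfolding nil_def ..
qed

lemma nil_of_e: "nil a c (e a c u) \<Longrightarrow> nil a c u"
  unfolding nil_def by (metis funpow_Suc_right o_apply)

lemma nil_scale:
  assumes "a \<in> {1..n}" "c \<in> {1..n}" "u \<in> M" "nil a c u"
  shows "nil a c (k *s u)"
proof -
  interpret subspace_operator scale M "e a c" by (rule operator_e) fact+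
  show ?thesis using assms unfolding nil_def by (auto simp: pow_scale)
qed

lemma nil_add:
  assumes "a \<in> {1..n}" "c \<in> {1..n}" "u \<in> M" "w \<in> M" "nil a c u" "nil a c w"
  shows "nil a c (u + w)"
proof -
  interpret subspace_operator scale M "e a c" by (rule operator_e) fact+
  obtain j k where jk: "(e a c ^^ j) u = 0" "(e a c ^^ k) w = 0"
    using assms(5,6) unfolding nil_def by blast
  have "(e a c ^^ (j + k)) (u + w) = 0"
    using pow_eq_0_mono[OF jk(1), of "j + k"] pow_eq_0_mono[OF jk(2), of "j + k"] assms(3,4)
    by (simp add: pow_add)
  then show ?thesis unfolding nil_def ..
qed

text \<open>Induction on the power killing \<open>u\<close>: \<open>e a c u\<close> needs one power
  fewer, and the remainder \<open>r u\<close> is nilpotent by assumption. Hence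
  \<open>e a c (e p q u)\<close> is nilpotent, and by \<open>nil_of_e\<close> so is
  \<open>e p q u\<close>.\<close>

lemma nil_transfer:
  assumes "a \<in> {1..n}" "c \<in> {1..n}" "p \<in> {1..n}" "q \<in> {1..n}" "u \<in> M" "nil a c u"
    and r: "\<And>u. u \<in> M \<Longrightarrow> e a c (e p q u) = k *s e p q (e a c u) + r u"
      "\<And>u. u \<in> M \<Longrightarrow> nil a c u \<Longrightarrow> r u \<in> M \<and> nil a c (r u)"
  shows "nil a c (e p q u)"
proof -
  interpret ac: subspace_operator scale M "e a c" by (rule operator_e) fact+
  interpret pq: subspace_operator scale M "e p q" by (rule operator_e) fact+
  have "nil a c (e p q u)" if "(e a c ^^ m) u = 0" "u \<in> M" for m u
    using that
  proof (induction m arbitrary: u)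
    case 0
    then show ?case by (auto simp: nil_def pq.T_zero intro: exI[of _ 0])
  next
    case (Suc m)
    have u: "(e a c ^^ m) (e a c u) = 0" using Suc.prems(1) by (simp add: funpow_swap1)
    have M: "e a c u \<in> M" "e p q (e a c u) \<in> M"
      using Suc.prems(2) by (auto intro: ac.T_closed pq.T_closed)
    have "nil a c u" using Suc.prems(1) unfolding nil_def by blast
    then have "nil a c (k *s e p q (e a c u) + r u)"
      using Suc.IH[OF u M(1)] r(2)[OF Suc.prems(2)] M M_subspace assms(1,2)
      by (intro nil_add nil_scale) (auto intro: subspace_scale)
    then show ?case using r(1)[OF Suc.prems(2)] nil_of_e by simp
  qed
  then show ?thesis using assms(5,6) unfolding nil_def by blast
qed

text \<open>Moving \<open>E_ac\<close> past \<open>E_pq\<close> produces only \<open>E_aq\<close>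
  and \<open>E_pc\<close>. Settling row \<open>a\<close> and column \<open>c\<close> first makes the
  remainder in the general case known.\<close>

lemma nil_stable:
  assumes "a \<in> {1..n}" "c \<in> {1..n}" "a \<noteq> c" "p \<in> {1..n}" "q \<in> {1..n}" "u \<in> M" "nil a c u"
  shows "nil a c (e p q u)"
proof -
  note ac = assms(1,2)
  have zero: "0 \<in> M \<and> nil a c 0"
    using M_subspace subspace_0 by (auto simp: nil_def intro: exI[of _ 0])
  \<comment> \<open>Off-diagonal units in row \<open>a\<close> or in column \<open>c\<close> commute
    with \<open>E_ac\<close> up to a factor, without remainder.\<close>
  have row: "nil a c (e a q u)" if "q \<in> {1..n}" "u \<in> M" "nil a c u" "q \<noteq> a" for q u
    by (rule nil_transfer[OF ac ac(1) that(1-3), where r = "\<lambda>_. 0"])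
       (use zero e_bracket[OF ac ac(1) that(1)] assms(3) that(4) in auto)
  have col: "nil a c (e p c u)" if "p \<in> {1..n}" "u \<in> M" "nil a c u" "p \<noteq> c" for p u
    by (rule nil_transfer[OF ac that(1) ac(2) that(2,3), where r = "\<lambda>_. 0"])
       (use zero e_bracket[OF ac that(1) ac(2)] assms(3) that(4) in auto)
  have self: "(- k) *s e a c u \<in> M \<and> nil a c ((- k) *s e a c u)" if "u \<in> M" "nil a c u" for k u
    using that ac M_subspace by (auto intro!: nil_scale nil_e e_closed subspace_scale simp del: scale_minus_left)
  \<comment> \<open>The bracket with a diagonal unit returns only a multiple of \<open>E_ac\<close>
    itself.\<close>
  have diag: "nil a c (e a a u)" if "u \<in> M" "nil a c u" for u
    by (rule nil_transfer[OF ac ac(1) ac(1) that,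
          where r = "\<lambda>u. (- \<omega> (\<gamma> a - \<gamma> c) (\<gamma> a - \<gamma> a)) *s e a c u"])
       (use self e_bracket[OF ac ac(1) ac(1)] assms(3) in auto)
  have diag': "nil a c (e c c u)" if "u \<in> M" "nil a c u" for u
    by (rule nil_transfer[OF ac ac(2) ac(2) that, where r = "\<lambda>u. e a c u"])
       (use nil_e[OF ac] e_closed[OF ac] e_bracket[OF ac ac(2) ac(2)] assms(3) in auto)
  have row': "nil a c (e a q u)" if "q \<in> {1..n}" "u \<in> M" "nil a c u" for q u
    using row diag that by (cases "q = a") auto
  have col': "nil a c (e p c u)" if "p \<in> {1..n}" "u \<in> M" "nil a c u" for p u
    using col diag' that by (cases "p = c") auto
  let ?w = "\<omega> (\<gamma> a - \<gamma> c) (\<gamma> p - \<gamma> q)"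
  let ?r = "\<lambda>u. (if c = p then 1 else 0) *s e a q u + (if q = a then - ?w else 0) *s e p c u"
  show ?thesis
  proof (rule nil_transfer[OF ac assms(4-7), where r = ?r and k = ?w])
    show "e a c (e p q u) = ?w *s e p q (e a c u) + ?r u" if "u \<in> M" for u
      unfolding e_bracket[OF ac assms(4,5) that] by auto
    fix u assume u: "u \<in> M" "nil a c u"
    have M: "e a q u \<in> M" "e p c u \<in> M" using u ac assms(4,5) by (auto intro: e_closed)
    show "?r u \<in> M \<and> nil a c (?r u)"
      by (intro conjI nil_add nil_scale ac subspace_add[OF M_subspace] subspace_scale[OF M_subspace]
            M row' col' assms(4,5) u)
  qed
qed

text \<open>Every vector is a combination of words in \<open>w\<close>, and
  \<open>nil_stable\<close> carries nilpotency along each word.\<close>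

lemma nil_everywhere:
  assumes "a \<in> {1..n}" "c \<in> {1..n}" "a \<noteq> c" "homog w" "w \<noteq> 0" "nil a c w" "u \<in> M"
  shows "nil a c u"
proof -
  interpret subspace_operator scale M "e a c" by (rule operator_e) fact+
  let ?W = "words ({1..n} \<times> {1..n}) w"
  have W: "x \<in> M \<and> nil a c x" if "x \<in> ?W" for x
    using that
  proof induction
    case words_base then show ?case using assms homog_in_M by blast
  next
    case (words_step x p q)
    then show ?case using nil_stable[OF assms(1-3)] e_closed by blast
  qed
  have "u \<in> span ?W" using span_words_all assms by blast
  then have "u \<in> M \<and> nil a c u"
  proof (induction rule: span_induct_alt)
    case base
    then show ?case using M_subspace subspace_0 by (auto simp: nil_def intro: exI[of _ 0])
  next
    case (step k x y)
    then show ?case using W[of x] assms(1,2) M_subspace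
      by (auto intro!: nil_add nil_scale subspace_add subspace_scale)
  qed
  then show ?thesis ..
qed

text \<open>If \<open>x u = 0\<close> and \<open>y\<^sup>k u = 0\<close>, then \<open>0 = x y\<^sup>k u\<close> is a nonzero multiple of \<open>y\<^bsup>k-1\<^esup> z u\<close> for \<open>z = [x, y]\<close>; iterating, powers
  of \<open>y\<close> killing \<open>u\<close> are traded for powers of \<open>z\<close>.\<close>

lemma nil_commutator:
  assumes b: "b \<in> {1..n}" and m: "m \<in> {1..n}" and a: "a \<in> {1..n}" and ne: "b \<noteq> m" "m \<noteq> a" "b \<noteq> a"
    and even: "\<omega> (\<gamma> m - \<gamma> a) (\<gamma> m - \<gamma> a) = 1"
    and x_nil: "\<And>u. u \<in> M \<Longrightarrow> nil b m u" and y_nil: "\<And>u. u \<in> M \<Longrightarrow> nil m a u"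
    and u: "u \<in> M"
  shows "nil b a u"
proof -
  interpret x: subspace_operator scale M "e b m" by (rule operator_e) fact+
  interpret y: subspace_operator scale M "e m a" by (rule operator_e) fact+
  interpret z: subspace_operator scale M "e b a" by (rule operator_e) fact+
  define c where "c = \<omega> (\<gamma> b - \<gamma> m) (\<gamma> m - \<gamma> a)"
  have c0: "c \<noteq> 0" unfolding c_def by (rule cf_nonzero[OF omega])
  \<comment> \<open>The degree of \<open>z\<close> is the sum of those of \<open>x\<close> and
    \<open>y\<close>, and \<open>y\<close> has factor 1 with itself, so moving \<open>z\<close> past
    \<open>y\<close> costs the same factor \<open>c\<close> as moving \<open>x\<close> past
    \<open>y\<close>.\<close>
  have "\<omega> (\<gamma> b - \<gamma> a) (\<gamma> m - \<gamma> a) = c"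
    using even cf_add_left[OF omega, of "\<gamma> b - \<gamma> m" "\<gamma> m - \<gamma> a" "\<gamma> m - \<gamma> a"] by (simp add: c_def)
  then have zy: "e b a (e m a u) = c *s e m a (e b a u)" if "u \<in> M" for u
    using e_bracket[OF b a m a that] ne by simp
  have xy: "e b m (e m a u) = c *s e m a (e b m u) + e b a u" if "u \<in> M" for u
    using e_bracket[OF b m m a that] ne by (simp add: c_def)
  have xz: "e b m (e b a u) = 0" if "u \<in> M" "e b m u = 0" for u
    using e_bracket[OF b m b a that(1)] ne that(2) by (simp add: z.T_zero)
  have zyk: "e b a ((e m a ^^ k) u) = c ^ k *s (e m a ^^ k) (e b a u)" if "u \<in> M" for u k
    by (induction k) (use that in \<open>simp_all add: zy y.pow_closed z.T_closed y.T_scale mult.commute\<close>)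
  have xyk: "e b m ((e m a ^^ Suc k) u) = (of_nat (Suc k) * c ^ k) *s (e m a ^^ k) (e b a u)"
    if "u \<in> M" "e b m u = 0" for u k
  proof (induction k)
    case 0
    then show ?case using xy[OF that(1)] that(2) by (simp add: y.T_zero)
  next
    case (Suc k)
    have "e b m ((e m a ^^ Suc (Suc k)) u)
        = c *s e m a (e b m ((e m a ^^ Suc k) u)) + e b a ((e m a ^^ Suc k) u)"
      using xy[of "(e m a ^^ Suc k) u"] y.pow_closed[OF that(1)] by (simp add: y.T_closed)
    also have "\<dots> = (c * (of_nat (Suc k) * c ^ k) + c ^ Suc k) *s (e m a ^^ Suc k) (e b a u)"
      unfolding Suc zyk[OF that(1)] using that(1)
      by (simp only: y.T_scale y.pow_closed z.T_closed scale_left_distrib scale_scale funpow.simps o_apply)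
    also have "c * (of_nat (Suc k) * c ^ k) + c ^ Suc k = of_nat (Suc (Suc k)) * c ^ Suc k"
      by (simp add: algebra_simps)
    finally show ?case .
  qed
  have z_nil: "nil b a u" if "(e m a ^^ k) u = 0" "u \<in> M" "e b m u = 0" for k u
    using that
  proof (induction k arbitrary: u)
    case 0
    then show ?case by (auto simp: nil_def intro: exI[of _ 0])
  next
    case (Suc k)
    have "(of_nat (Suc k) * c ^ k) *s (e m a ^^ k) (e b a u) = 0"
      using xyk[OF Suc.prems(2,3), of k] Suc.prems(1) by (simp add: x.T_zero)
    then have "(e m a ^^ k) (e b a u) = 0"
      using c0 by (simp add: of_nat_eq_0_iff[symmetric] del: of_nat_eq_0_iff of_nat_Suc)
    then show ?case
      using Suc.IH[of "e b a u"] xz[OF Suc.prems(2,3)] z.T_closed[OF Suc.prems(2)] nil_of_e by blast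
  qed
  \<comment> \<open>The last nonzero power of \<open>x\<close> on a homogeneous vector is a
    homogeneous vector killed by \<open>x\<close>; nilpotency of \<open>z\<close> there spreads to
    all of \<open>M\<close>.\<close>
  obtain w where w: "homog w" "w \<noteq> 0" by (rule homog_nonzero_exists)
  obtain k where "(e b m ^^ k) w = 0" using x_nil[OF homog_in_M[OF w(1)]] unfolding nil_def by blast
  then obtain j where j: "(e b m ^^ j) w \<noteq> 0" "e b m ((e b m ^^ j) w) = 0"
    using x.last_nonzero_power w(2) by blast
  have h: "homog ((e b m ^^ j) w)" using b m w(1) by (rule homog_pow)
  obtain k where "(e m a ^^ k) ((e b m ^^ j) w) = 0" using y_nil[OF homog_in_M[OF h]] unfolding nil_def by blast
  then have "nil b a ((e b m ^^ j) w)" using z_nil j(2) homog_in_M[OF h] by blast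
  then show ?thesis using nil_everywhere[OF b a ne(3) h j(1) _ u] by blast
qed

text \<open>Here \<open>E_ac\<close> is odd, so its bracket with itself is twice its square, while
  \<open>a \<noteq> c\<close> makes that bracket zero.\<close>

lemma nil_odd:
  assumes a: "a \<in> {1..n}" and c: "c \<in> {1..n}" and odd: "\<omega> (\<gamma> a) (\<gamma> a) \<noteq> \<omega> (\<gamma> c) (\<gamma> c)" and u: "u \<in> M"
  shows "nil a c u"
proof -
  have "\<omega> (\<gamma> a - \<gamma> c) (\<gamma> a - \<gamma> c) = -1"
    using odd cf_self[OF omega, of "\<gamma> a"] cf_self[OF omega, of "\<gamma> c"]
    by (auto simp: cf_self_diff[OF omega])
  moreover have "a \<noteq> c" using odd by auto
  ultimately have "e a c (e a c u) = - e a c (e a c u)" using e_bracket[OF a c a c u] by simp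
  then have "2 *s e a c (e a c u) = 0"
    using scale_left_distrib[of 1 1 "e a c (e a c u)"] by (simp add: eq_neg_iff_add_eq_0)
  then have "(e a c ^^ 2) u = 0" by (simp add: numeral_2_eq_2)
  then show ?thesis unfolding nil_def ..
qed

subsection \<open>Highest weight vectors\<close>

definition weight_vector :: "(nat \<Rightarrow> complex) \<Rightarrow> 'm \<Rightarrow> bool" where
  "weight_vector l u \<longleftrightarrow> homog u \<and> u \<noteq> 0 \<and> (\<forall>p\<in>{1..n}. e p p u = l p *s u)"

definition highest_vector :: "(nat \<Rightarrow> complex) \<Rightarrow> 'm \<Rightarrow> bool" where
  "highest_vector l u \<longleftrightarrow> weight_vector l u \<and> (\<forall>a\<in>{1..n}. \<forall>c\<in>{1..n}. a < c \<longrightarrow> e a c u = 0)"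

section \<open>Weight shifts and the height operator\<close>

lemma e_diagonal_shift:
  assumes p: "p \<in> {1..n}" and a: "a \<in> {1..n}" and c: "c \<in> {1..n}" and u: "u \<in> M"
  shows "e p p (e a c u) = e a c (e p p u) + ((if p = a then 1 else 0) - (if p = c then 1 else 0)) *s e a c u"
  using e_bracket[OF p p a c u] by (simp add: cf_zero_left[OF omega])

text \<open>The weights \<open>-p\<close> are chosen so that the commutator with \<open>E_ac\<close>
  is \<open>(c - a) E_ac\<close>: raising operators increase the height, lowering operators decrease
  it, by a positive integer.\<close>

definition height_op :: "'m \<Rightarrow> 'm" where
  "height_op u = (\<Sum>p\<in>{1..n}. (- of_nat p) *s e p p u)"

definition height :: "(nat \<Rightarrow> complex) \<Rightarrow> complex" where
  "height l = (\<Sum>p\<in>{1..n}. - of_nat p * l p)"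

lemma operator_height: "subspace_operator scale M height_op"
proof
  show "height_op u \<in> M" if "u \<in> M" for u
    unfolding height_op_def using that
    by (intro subspace_sum[OF M_subspace] subspace_scale[OF M_subspace] e_closed) auto
  show "height_op (u + w) = height_op u + height_op w" if "u \<in> M" "w \<in> M" for u w
    unfolding height_op_def sum.distrib[symmetric]
    by (intro sum.cong refl) (simp add: e_add that scale_right_distrib del: scale_minus_left)
  show "height_op (k *s u) = k *s height_op u" if "u \<in> M" for u k
    unfolding height_op_def scale_sum_right
    by (intro sum.cong refl) (simp add: e_scale that scale_left_commute del: scale_minus_left)
qed (rule M_subspace)

lemma height_op_weight:
  assumes "weight_vector l u"
  shows "height_op u = height l *s u"
  unfolding height_op_def height_def scale_sum_left
  by (intro sum.cong refl) (use assms in \<open>simp add: weight_vector_def\<close>)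

lemma height_op_shift:
  assumes a: "a \<in> {1..n}" and c: "c \<in> {1..n}" and u: "u \<in> M" and h: "height_op u = h *s u"
  shows "height_op (e a c u) = (h + of_nat c - of_nat a) *s e a c u"
proof -
  interpret subspace_operator scale M "e a c" by (rule operator_e) fact+
  have "height_op (e a c u) = (\<Sum>p\<in>{1..n}. (- of_nat p) *s e a c (e p p u) +
      (- of_nat p * ((if p = a then 1 else 0) - (if p = c then 1 else 0))) *s e a c u)"
    unfolding height_op_def
    by (intro sum.cong refl) (simp only: e_diagonal_shift[OF _ a c u] scale_right_distrib scale_scale)
  also have "\<dots> = (\<Sum>p\<in>{1..n}. (- of_nat p) *s e a c (e p p u)) +
      (\<Sum>p\<in>{1..n}. - of_nat p * ((if p = a then 1 else 0) - (if p = c then 1 else 0))) *s e a c u"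
    by (simp only: sum.distrib scale_sum_left)
  also have "(\<Sum>p\<in>{1..n}. (- of_nat p) *s e a c (e p p u)) = e a c (height_op u)"
    unfolding height_op_def using u
    by (subst T_sum) (auto simp: T_scale e_closed simp del: scale_minus_left
        intro!: sum.cong subspace_scale[OF M_subspace])
  also have "\<dots> = h *s e a c u" unfolding h by (rule T_scale[OF u])
  also have "(\<Sum>p\<in>{1..n}. - of_nat p * ((if p = a then 1 else 0) - (if p = c then 1 else 0)))
      = (of_nat c - of_nat a :: complex)"
  proof -
    have "(\<Sum>p\<in>{1..n}. - of_nat p * ((if p = a then 1 else 0) - (if p = c then 1 else 0)))
      = (\<Sum>p\<in>{1..n}. (if p = c then of_nat p else 0) - (if p = a then of_nat p else (0::complex)))"
      by (intro sum.cong refl) auto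
    then show ?thesis using a c by (simp add: sum_subtractf)
  qed
  finally show ?thesis by (simp only: scale_left_distrib[symmetric] add_diff_eq)
qed

lemma weight_vector_shift:
  assumes a: "a \<in> {1..n}" and c: "c \<in> {1..n}" and u: "weight_vector l u" and nz: "e a c u \<noteq> 0"
  shows "weight_vector (\<lambda>p. l p + (if p = a then 1 else 0) - (if p = c then 1 else 0)) (e a c u)"
proof -
  have M: "u \<in> M" and h: "homog (e a c u)" and l: "\<And>p. p \<in> {1..n} \<Longrightarrow> e p p u = l p *s u"
    using u homog_in_M homog_e a c unfolding weight_vector_def by blast+
  have "e p p (e a c u) = (l p + (if p = a then 1 else 0) - (if p = c then 1 else 0)) *s e a c u"
    if p: "p \<in> {1..n}" for p
    unfolding e_diagonal_shift[OF p a c M] l[OF p] e_scale[OF a c M]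
    by (simp only: scale_left_distrib[symmetric] add_diff_eq)
  then show ?thesis using nz h unfolding weight_vector_def by blast
qed

lemma weight_pow:
  assumes p: "p \<in> {1..n}" and a: "a \<in> {1..n}" and c: "c \<in> {1..n}"
    and u: "u \<in> M" "e p p u = k *s u"
  shows "e p p ((e a c ^^ j) u) =
    (k + of_nat j * ((if p = a then 1 else 0) - (if p = c then 1 else 0))) *s (e a c ^^ j) u"
proof (induction j)
  case 0
  then show ?case using u by simp
next
  case (Suc j)
  interpret subspace_operator scale M "e a c" by (rule operator_e) fact+
  have m: "(e a c ^^ j) u \<in> M" by (rule pow_closed[OF u(1)])
  show ?case
    by (simp only: funpow.simps o_apply e_diagonal_shift[OF p a c m] Suc T_scale[OF m]
        scale_left_distrib[symmetric] of_nat_Suc) (simp add: algebra_simps del: scale_left_distrib scale_left_diff_distrib)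
qed

text \<open>Equal parities make the colour factor of \<open>E_ac\<close> and \<open>E_ca\<close>
  equal to 1, so together with \<open>E_aa - E_cc\<close> they satisfy the usual \<open>sl_2\<close>
  string formula.\<close>

lemma sl2_relation:
  assumes a: "a \<in> {1..n}" and c: "c \<in> {1..n}" and ne: "a \<noteq> c"
    and even: "\<omega> (\<gamma> a) (\<gamma> a) = \<omega> (\<gamma> c) (\<gamma> c)"
    and u: "u \<in> M" "e a c u = 0" "e a a u = k *s u" "e c c u = l *s u"
  shows "e a c ((e c a ^^ Suc j) u) = (of_nat (Suc j) * (k - l - of_nat j)) *s (e c a ^^ j) u"
proof -
  interpret f: subspace_operator scale M "e c a" by (rule operator_e) fact+
  interpret e: subspace_operator scale M "e a c" by (rule operator_e) fact+
  have "\<omega> (\<gamma> a - \<gamma> c) (\<gamma> c - \<gamma> a) = 1"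
    using even cf_self_square[OF omega] by (simp add: cf_diff_swap[OF omega])
  then have ef: "e a c (e c a w) = e c a (e a c w) + (e a a w - e c c w)" if "w \<in> M" for w
    using e_bracket[OF a c c a that] by simp
  \<comment> \<open>The added term is the weight \<open>k - l - 2 j\<close> of
    \<open>E_aa - E_cc\<close> on the \<open>j\<close>-th power; summing these weights from 0 to
    \<open>j\<close> gives the stated coefficient.\<close>
  have step: "e a c (e c a ((e c a ^^ j) u)) = e c a (e a c ((e c a ^^ j) u))
      + (k - l - 2 * of_nat j) *s (e c a ^^ j) u" for j
    using ne by (simp only: ef[OF f.pow_closed[OF u(1)]] weight_pow[OF a c a u(1,3)] weight_pow[OF c c a u(1,4)]
        scale_left_diff_distrib[symmetric]) (simp add: algebra_simps)
  show ?thesis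
  proof (induction j)
    case 0
    then show ?case using step[of 0] u by (simp add: f.T_zero)
  next
    case (Suc j)
    have "e a c ((e c a ^^ Suc (Suc j)) u) =
        (of_nat (Suc j) * (k - l - of_nat j)) *s (e c a ^^ Suc j) u
        + (k - l - 2 * of_nat (Suc j)) *s (e c a ^^ Suc j) u"
      using step[of "Suc j"] f.T_scale[OF f.pow_closed[OF u(1)], of _ j] Suc by simp
    also have "\<dots> = (of_nat (Suc j) * (k - l - of_nat j) + (k - l - 2 * of_nat (Suc j))) *s (e c a ^^ Suc j) u"
      by (simp only: scale_left_distrib)
    also have "of_nat (Suc j) * (k - l - of_nat j) + (k - l - 2 * of_nat (Suc j))
        = of_nat (Suc (Suc j)) * (k - l - of_nat (Suc j))"
      by (simp add: algebra_simps)
    finally show ?case .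
  qed
qed

text \<open>The vectors \<open>E_ca^k v\<close> have pairwise different
  \<open>E_aa\<close>-eigenvalues, so they vanish eventually. If the \<open>j\<close>-th is the last
  nonzero one, the string formula forces \<open>l a - l c = j\<close>.\<close>

lemma finite_dim_dominant:
  assumes B: "finite B" "M \<subseteq> span B" and v: "highest_vector l v"
    and a: "a \<in> {1..n}" and c: "c \<in> {1..n}" and ac: "a < c"
    and even: "\<omega> (\<gamma> a) (\<gamma> a) = \<omega> (\<gamma> c) (\<gamma> c)"
  shows "l a - l c \<in> \<nat>"
proof -
  interpret f: subspace_operator scale M "e c a" by (rule operator_e) fact+
  interpret h: subspace_operator scale M "e a a" by (rule operator_e) fact+
  have vM: "v \<in> M" and v0: "v \<noteq> 0" and va: "e a a v = l a *s v" and vc: "e c c v = l c *s v"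
    and ev: "e a c v = 0"
    using v a c ac homog_in_M unfolding highest_vector_def weight_vector_def by auto
  have "\<exists>k. (e c a ^^ k) v = 0"
  proof (rule ccontr)
    assume "\<not> ?thesis"
    then have nz: "(e c a ^^ k) v \<noteq> 0" for k by blast
    have "e a a ((e c a ^^ k) v) = (l a - of_nat k) *s (e c a ^^ k) v" for k
      using weight_pow[OF a c a vM va] ac by simp
    then have "range (\<lambda>k. l a - of_nat k) \<subseteq> {d. \<exists>u\<in>M. u \<noteq> 0 \<and> e a a u = d *s u}"
      using nz f.pow_closed[OF vM] by blast
    then have "finite (range (\<lambda>k. l a - of_nat k))"
      using h.finite_eigenvalues[OF B] finite_subset by blast
    moreover have "inj (\<lambda>k. l a - of_nat k)" by (rule injI) simp
    ultimately show False using finite_imageD by blast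
  qed
  then obtain k where "(e c a ^^ k) v = 0" ..
  then obtain j where j: "(e c a ^^ j) v \<noteq> 0" "e c a ((e c a ^^ j) v) = 0"
    using f.last_nonzero_power v0 by blast
  interpret e: subspace_operator scale M "e a c" by (rule operator_e) fact+
  have "(of_nat (Suc j) * (l a - l c - of_nat j)) *s (e c a ^^ j) v = 0"
    using sl2_relation[OF a c _ even vM ev va vc, of j] ac j(2) by (simp add: e.T_zero)
  then have "of_nat (Suc j) * (l a - l c - of_nat j) = 0" using j(1) unfolding scale_eq_0_iff by blast
  then have "l a - l c = of_nat j" by (simp del: of_nat_Suc)
  then show ?thesis by simp
qed

section \<open>Generation by lowering operators and bounds on heights\<close>

abbreviation lowering :: "(nat \<times> nat) set" where
  "lowering \<equiv> {(c, a). a \<in> {1..n} \<and> c \<in> {1..n} \<and> a < c}"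

lemma lowering_subset: "lowering \<subseteq> {1..n} \<times> {1..n}"
  by auto

text \<open>The span of the lowering words is stable under every matrix unit: an arbitrary unit is
  moved past the leading lowering operator, and all terms then act on a shorter word.\<close>

lemma span_words_lowering:
  assumes v: "highest_vector l v"
  shows "span (words lowering v) = M"
proof -
  let ?S = "span (words lowering v)"
  have h: "homog v" and v0: "v \<noteq> 0" and vM: "v \<in> M"
    using v homog_in_M unfolding highest_vector_def weight_vector_def by auto
  have S: "subspace ?S" by (rule subspace_span)
  have wM: "x \<in> M" if "x \<in> words lowering v" for x
    using words_homog[OF lowering_subset h that] by (rule homog_in_M)
  have low: "e c a u \<in> ?S" if "a \<in> {1..n}" "c \<in> {1..n}" "a < c" "u \<in> ?S" for a c u
    by (rule span_words_stable[OF lowering_subset h _ that(4)]) (use that in auto)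
  \<comment> \<open>The bracket creates units with other indices, hence the induction over all
    \<open>a\<close> and \<open>c\<close> at once.\<close>
  have gen: "e a c x \<in> ?S" if "x \<in> words lowering v" "a \<in> {1..n}" "c \<in> {1..n}" for a c x
    using that
  proof (induction arbitrary: a c)
    case words_base
    consider "a < c" | "a = c" | "c < a" by linarith
    then show ?case
    proof cases
      case 1
      then show ?thesis using v words_base span_zero unfolding highest_vector_def by auto
    next
      case 2
      then have "e a c v = l a *s v" using v words_base
        unfolding highest_vector_def weight_vector_def by auto
      then show ?thesis by (simp add: span_scale span_base words.words_base)
    next
      case 3
      then show ?thesis using low words_base by (simp add: span_base words.words_base)
    qed
  next
    case (words_step x p q)
    then have pq: "p \<in> {1..n}" "q \<in> {1..n}" "q < p" by auto
    show ?case
      unfolding e_bracket[OF words_step.prems pq(1,2) wM[OF words_step.hyps(1)]]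
      using words_step.IH[OF words_step.prems] words_step.IH[OF words_step.prems(1) pq(2)]
        words_step.IH[OF pq(1) words_step.prems(2)]
      by (intro subspace_add[OF S] subspace_diff[OF S] subspace_scale[OF S] low[OF pq(2,1,3)])
        (simp_all add: span_zero span_scale)
  qed
  have "words ({1..n} \<times> {1..n}) v \<subseteq> ?S"
  proof
    fix x assume "x \<in> words ({1..n} \<times> {1..n}) v"
    then show "x \<in> ?S"
    proof induction
      case words_base
      then show ?case by (intro span_base words.words_base)
    next
      case (words_step x a c)
      then have ac: "a \<in> {1..n}" "c \<in> {1..n}" by auto
      interpret subspace_operator scale M "e a c" using ac by (rule operator_e)
      show ?case by (rule T_span[OF _ _ words_step.IH]) (use wM gen ac in auto)
    qed
  qed
  then have "M \<subseteq> ?S" using span_words_all[OF h v0] span_minimal[OF _ S] by blast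
  moreover have "?S \<subseteq> M" using wM by (intro span_minimal[OF _ M_subspace]) auto
  ultimately show ?thesis by (rule subset_antisym[rotated])
qed

text \<open>The lowering words span \<open>M\<close> and are height eigenvectors with eigenvalues
  \<open>height l - k\<close>; an eigenvector with any other eigenvalue vanishes.\<close>

lemma highest_vector_height_le:
  assumes v: "highest_vector l v" and u: "weight_vector l' u"
  shows "\<exists>k. height l' = height l - of_nat k"
proof (rule ccontr)
  assume ne: "\<nexists>k. height l' = height l - of_nat k"
  interpret subspace_operator scale M height_op by (rule operator_height)
  have h: "homog v" and wv: "weight_vector l v" using v unfolding highest_vector_def weight_vector_def by auto
  have w: "\<exists>k. height_op x = (height l - of_nat k) *s x" if "x \<in> words lowering v" for x
    using that
  proof induction
    case words_base
    then show ?case using height_op_weight[OF wv] by (intro exI[of _ 0]) simp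
  next
    case (words_step x c a)
    then obtain k where k: "height_op x = (height l - of_nat k) *s x" by blast
    have ac: "a \<in> {1..n}" "c \<in> {1..n}" "a < c" using words_step by auto
    have "height_op (e c a x) = (height l - of_nat k + of_nat a - of_nat c) *s e c a x"
      using words_homog[OF lowering_subset h words_step.hyps(1)]
      by (intro height_op_shift ac k homog_in_M)
    also have "height l - of_nat k + of_nat a - of_nat c = height l - of_nat (k + (c - a))"
      using ac(3) by (simp add: of_nat_diff)
    finally show ?case by blast
  qed
  have "u = 0"
  proof (rule eigenvector_in_span[where c = "height l'" and E = "words lowering v"])
    show "height_op u = height l' *s u" by (rule height_op_weight[OF u])
    show "u \<in> span (words lowering v)"
      using span_words_lowering[OF v] u homog_in_M unfolding weight_vector_def by blast
    fix x assume x: "x \<in> words lowering v"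
    obtain k where "height_op x = (height l - of_nat k) *s x" using w[OF x] ..
    then show "x \<in> M \<and> (\<exists>d. height_op x = d *s x \<and> d \<noteq> height l')"
      using homog_in_M[OF words_homog[OF lowering_subset h x]] ne by metis
  qed
  then show False using u unfolding weight_vector_def by blast
qed

text \<open>If nonzero, this power would be a second highest weight vector, of smaller height. It
  would generate \<open>M\<close> by lowering operators, so \<open>v\<close> could not lie above
  it.\<close>

lemma simple_root_power_zero:
  assumes v: "highest_vector l v" and a: "a \<in> {1..n}" and c: "Suc a \<in> {1..n}"
    and even: "\<omega> (\<gamma> a) (\<gamma> a) = \<omega> (\<gamma> (Suc a)) (\<gamma> (Suc a))"
    and m: "l a - l (Suc a) = of_nat m"
  shows "(e (Suc a) a ^^ Suc m) v = 0"
proof (rule ccontr)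
  let ?f = "e (Suc a) a"
  assume nz: "(?f ^^ Suc m) v \<noteq> 0"
  interpret f: subspace_operator scale M ?f by (rule operator_e) fact+
  have h: "homog v" and vM: "v \<in> M" and wv: "weight_vector l v"
    using v homog_in_M unfolding highest_vector_def weight_vector_def by auto
  have hi: "e p q v = 0" if "p \<in> {1..n}" "q \<in> {1..n}" "p < q" for p q
    using v that unfolding highest_vector_def by blast
  have wt: "e p p v = l p *s v" if "p \<in> {1..n}" for p
    using wv that unfolding weight_vector_def by blast
  \<comment> \<open>No index lies strictly between \<open>a\<close> and \<open>Suc a\<close>. Hence
    the bracket terms \<open>E_pa\<close> (for \<open>q = Suc a\<close>) and
    \<open>E_{Suc a, q}\<close> (for \<open>p = a\<close>) are again raising operators other than
    \<open>E_{a, Suc a}\<close>.\<close>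
  have other: "e p q ((?f ^^ k) v) = 0"
    if "p \<in> {1..n}" "q \<in> {1..n}" "p < q" "(p, q) \<noteq> (a, Suc a)" for p q k
    using that
  proof (induction k arbitrary: p q)
    case 0
    then show ?case using hi by simp
  next
    case (Suc k)
    have "e p q ((?f ^^ k) v) = 0" using Suc by blast
    moreover have "e p a ((?f ^^ k) v) = 0" if "q = Suc a"
      using Suc.IH[of p a] Suc.prems that a by auto
    moreover have "e (Suc a) q ((?f ^^ k) v) = 0" if "a = p"
      using Suc.IH[of "Suc a" q] Suc.prems that c by auto
    ultimately show ?case
      using e_bracket[OF Suc.prems(1,2) c a f.pow_closed[OF vM, of k]] by (auto simp: f.T_zero)
  qed
  \<comment> \<open>The exponent \<open>Suc m\<close> is the one at which the coefficient of the
    string formula contains the factor \<open>m - m\<close>.\<close>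
  have simple: "e a (Suc a) ((?f ^^ Suc m) v) = 0"
    using sl2_relation[OF a c _ even vM hi[OF a c] wt[OF a] wt[OF c], of m] m
    by (simp del: funpow.simps)
  have wk: "\<exists>l'. weight_vector l' ((?f ^^ k) v)" if "(?f ^^ k) v \<noteq> 0" for k
    using that
  proof (induction k)
    case 0
    then show ?case using wv by auto
  next
    case (Suc k)
    then have "(?f ^^ k) v \<noteq> 0" by (auto simp: f.T_zero)
    then show ?case using Suc weight_vector_shift[OF c a] by auto
  qed
  obtain l' where l': "weight_vector l' ((?f ^^ Suc m) v)" using wk[OF nz] ..
  have "e p q ((?f ^^ Suc m) v) = 0" if "p \<in> {1..n}" "q \<in> {1..n}" "p < q" for p q
    using other[OF that, of "Suc m"] simple by (cases "(p, q) = (a, Suc a)") auto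
  then have hv: "highest_vector l' ((?f ^^ Suc m) v)" using l' unfolding highest_vector_def by blast
  have shift: "height_op ((?f ^^ k) v) = (height l - of_nat k) *s (?f ^^ k) v" for k
  proof (induction k)
    case 0
    then show ?case using height_op_weight[OF wv] by simp
  next
    case (Suc k)
    show ?case using height_op_shift[OF c a f.pow_closed[OF vM] Suc] by (simp add: algebra_simps)
  qed
  have "height l' *s (?f ^^ Suc m) v = (height l - of_nat (Suc m)) *s (?f ^^ Suc m) v"
    using height_op_weight[OF l'] shift[of "Suc m"] by (simp only:)
  then have "height l' = height l - of_nat (Suc m)" using nz unfolding scale_cancel_right by blast
  \<comment> \<open>The roles are exchanged: the new vector serves as the highest one, and
    \<open>v\<close> is an arbitrary weight vector.\<close>
  moreover obtain k where "height l = height l' - of_nat k"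
    using highest_vector_height_le[OF hv wv] ..
  ultimately have "of_nat (Suc m) + of_nat k = (0 :: complex)" by algebra
  then have "of_nat (Suc m + k) = (0 :: complex)" by (simp only: of_nat_add)
  then show False unfolding of_nat_eq_0_iff by simp
qed

subsection \<open>Finite dimensionality\<close>

text \<open>Odd units square to zero. Even units are treated by induction on \<open>c - a\<close>,
  starting from simple roots and writing \<open>E_ca\<close> as the bracket of \<open>E_cb\<close>
  and \<open>E_ba\<close>.\<close>

lemma nil_lowering:
  assumes v: "highest_vector l v"
    and dom: "\<And>a. a \<in> {1..n} \<Longrightarrow> Suc a \<in> {1..n} \<Longrightarrow> \<omega> (\<gamma> a) (\<gamma> a) = \<omega> (\<gamma> (Suc a)) (\<gamma> (Suc a)) \<Longrightarrow>
      l a - l (Suc a) \<in> \<nat>"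
    and ca: "(c, a) \<in> lowering" and u: "u \<in> M"
  shows "nil c a u"
proof (cases "\<omega> (\<gamma> c) (\<gamma> c) = \<omega> (\<gamma> a) (\<gamma> a)")
  case False
  then show ?thesis using nil_odd ca u by auto
next
  case True
  have "nil c a u" if "c - a = Suc d" "a \<in> {1..n}" "c \<in> {1..n}" "\<omega> (\<gamma> c) (\<gamma> c) = \<omega> (\<gamma> a) (\<gamma> a)" "u \<in> M" for d c u
    using that
  proof (induction d arbitrary: c u)
    case 0
    then have c: "c = Suc a" by simp
    then obtain m where "l a - l (Suc a) = of_nat m" using dom[of a] 0 Nats_cases by metis
    then have "(e (Suc a) a ^^ Suc m) v = 0" using simple_root_power_zero[OF v] 0 c by metis
    then have "nil c a v" unfolding nil_def c by blast
    then show ?case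
      using v 0 c nil_everywhere unfolding highest_vector_def weight_vector_def by auto
  next
    case (Suc d)
    \<comment> \<open>With this choice \<open>E_cb\<close> belongs to a simple root and
      \<open>E_ba\<close> is covered by the induction hypothesis.\<close>
    define b where "b = c - 1"
    have b: "c = Suc b" "a < b" "b - a = Suc d" "b \<in> {1..n}" using Suc.prems unfolding b_def by auto
    \<comment> \<open>Even indices precede odd ones, so an index between two of equal parity has
      that parity too.\<close>
    have "\<omega> (\<gamma> b) (\<gamma> b) = \<omega> (\<gamma> a) (\<gamma> a)"
      using cf_self[OF omega, of "\<gamma> a"] cf_self[OF omega, of "\<gamma> b"] Suc.prems(4)
        parity_mono[OF b(4) Suc.prems(3)] parity_mono[OF Suc.prems(2) b(4)] b(1,2) by auto
    then have even: "\<omega> (\<gamma> c) (\<gamma> c) = \<omega> (\<gamma> b) (\<gamma> b)" "\<omega> (\<gamma> b) (\<gamma> b) = \<omega> (\<gamma> a) (\<gamma> a)"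
      using Suc.prems(4) by auto
    have "nil c b w" if "w \<in> M" for w
    proof -
      obtain m where "l b - l (Suc b) = of_nat m" using dom[of b] b Suc.prems(3) even Nats_cases by metis
      then have "(e (Suc b) b ^^ Suc m) v = 0"
        using simple_root_power_zero[OF v, of b m] Suc.prems(3) even b by simp
      then have "nil c b v" unfolding nil_def b by blast
      then show ?thesis
        using v that b Suc.prems(3) nil_everywhere unfolding highest_vector_def weight_vector_def by auto
    qed
    moreover have "nil b a w" if "w \<in> M" for w
      using Suc.IH[OF b(3) Suc.prems(2) b(4) even(2) that] .
    moreover have "\<omega> (\<gamma> b - \<gamma> a) (\<gamma> b - \<gamma> a) = 1"
      using even(2) cf_self_square[OF omega] by (simp add: cf_self_diff[OF omega])
    ultimately show ?case using b Suc.prems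
      by (intro nil_commutator[of c b a]) auto
  qed
  from this[of c "c - a - 1"] show ?thesis using ca True u by auto
qed

text \<open>Local nilpotency bounds the exponents needed for each element of \<open>B\<close>. The
  second description of the span admits every exponent, so that a later induction on the exponent
  can ignore the bounds.\<close>

lemma powers_span:
  assumes a: "a \<in> {1..n}" and c: "c \<in> {1..n}" and B: "finite B" "B \<subseteq> M"
    and nil: "\<And>u. u \<in> M \<Longrightarrow> nil a c u"
  obtains B' where "finite B'" "B' \<subseteq> M" "B \<subseteq> B'" "\<And>u. u \<in> span B' \<Longrightarrow> e a c u \<in> span B'"
    "span B' = span {(e a c ^^ k) u |k u. u \<in> B}"
proof -
  interpret subspace_operator scale M "e a c" by (rule operator_e) fact+
  have "\<forall>u\<in>B. \<exists>k. (e a c ^^ k) u = 0" using nil B(2) unfolding nil_def by blast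
  from bchoice[OF this] obtain K where K: "\<And>u. u \<in> B \<Longrightarrow> (e a c ^^ K u) u = 0" by blast
  let ?P = "{(e a c ^^ k) u |k u. u \<in> B}"
  let ?B = "(\<Union>u\<in>B. (\<lambda>k. (e a c ^^ k) u) ` {..K u})"
  have in_B: "(e a c ^^ k) u \<in> span ?B" if "u \<in> B" for k u
  proof (cases "k \<le> K u")
    case True
    then show ?thesis using that by (intro span_base) auto
  next
    case False
    then have "(e a c ^^ k) u = 0" using pow_eq_0_mono[OF K[OF that]] by simp
    then show ?thesis by (simp add: span_zero)
  qed
  have M: "?B \<subseteq> M" using B(2) pow_closed by auto
  show thesis
  proof (rule that)
    show "finite ?B" using B(1) by auto
    show "?B \<subseteq> M" by (rule M)
    show "B \<subseteq> ?B" by (force intro: image_eqI[of _ _ 0])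
    show "e a c u \<in> span ?B" if "u \<in> span ?B" for u
    proof (rule T_span[OF M _ that])
      fix x assume "x \<in> ?B"
      then obtain u k where "u \<in> B" "x = (e a c ^^ k) u" by auto
      then show "e a c x \<in> span ?B" using in_B[of u "Suc k"] by simp
    qed
    show "span ?B = span ?P"
    proof
      show "span ?B \<subseteq> span ?P" by (rule span_mono) auto
      show "span ?P \<subseteq> span ?B" by (rule span_minimal[OF _ subspace_span]) (use in_B in auto)
    qed
  qed
qed

text \<open>One step of a Poincare--Birkhoff--Witt argument: \<open>T\<close> spans an ideal in the Lie algebra spanned
  by \<open>T\<close> and \<open>E\<^sub>c\<^sub>a\<close>.\<close>

lemma extend_stable:
  assumes ca: "(c, a) \<in> lowering" and T: "T \<subseteq> lowering" and B: "finite B" "B \<subseteq> M"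
    and nil: "\<And>u. u \<in> M \<Longrightarrow> nil c a u"
    and stable: "\<And>p q u. (p, q) \<in> T \<Longrightarrow> u \<in> span B \<Longrightarrow> e p q u \<in> span B"
    and ideal: "\<And>p q. (p, q) \<in> T \<Longrightarrow> (q = c \<longrightarrow> (p, a) \<in> T) \<and> (a = p \<longrightarrow> (c, q) \<in> T)"
  shows "\<exists>B'. finite B' \<and> B' \<subseteq> M \<and> B \<subseteq> B' \<and>
    (\<forall>p q u. (p, q) \<in> insert (c, a) T \<longrightarrow> u \<in> span B' \<longrightarrow> e p q u \<in> span B')"
proof -
  have c: "c \<in> {1..n}" and a: "a \<in> {1..n}" and ac: "a < c" using ca by auto
  interpret subspace_operator scale M "e c a" by (rule operator_e) fact+
  obtain B' where B': "finite B'" "B' \<subseteq> M" "B \<subseteq> B'" "\<And>u. u \<in> span B' \<Longrightarrow> e c a u \<in> span B'"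
    "span B' = span {(e c a ^^ k) u |k u. u \<in> B}"
    using powers_span[OF c a B nil] by blast
  have S: "subspace (span B')" by (rule subspace_span)
  \<comment> \<open>Moving \<open>E_pq\<close> past \<open>E_ca\<close> may replace it by
    \<open>E_pa\<close> or \<open>E_cq\<close>. Both remain in \<open>T\<close>, but the indices
    change, so \<open>p\<close> and \<open>q\<close> are generalised.\<close>
  have gen: "e p q ((e c a ^^ k) u) \<in> span B'" if "(p, q) \<in> T" "u \<in> B" for p q k u
    using that(1)
  proof (induction k arbitrary: p q)
    case 0
    then show ?case using stable[OF 0 span_base[OF that(2)]] span_mono[OF B'(3)] by auto
  next
    case (Suc k)
    have pq: "p \<in> {1..n}" "q \<in> {1..n}" using Suc.prems T by auto
    have M: "(e c a ^^ k) u \<in> M" using B(2) that(2) by (intro pow_closed) auto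
    have "e p q (e c a ((e c a ^^ k) u)) \<in> span B'"
      unfolding e_bracket[OF pq c a M]
      using ideal[OF Suc.prems] Suc.IH
      by (intro subspace_add[OF S] subspace_diff[OF S] subspace_scale[OF S] B'(4) Suc.IH[OF Suc.prems])
        (auto simp: span_zero intro!: span_scale)
    then show ?case by simp
  qed
  have "e p q u \<in> span B'" if "(p, q) \<in> insert (c, a) T" "u \<in> span B'" for p q u
  proof (cases "(p, q) = (c, a)")
    case True
    then show ?thesis using B'(4) that(2) by simp
  next
    case False
    then have pq: "(p, q) \<in> T" using that(1) by blast
    interpret pq: subspace_operator scale M "e p q" using pq T by (intro operator_e) auto
    show ?thesis
    proof (rule pq.T_span)
      show "{(e c a ^^ k) u |k u. u \<in> B} \<subseteq> M" using B(2) pow_closed by auto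
      show "u \<in> span {(e c a ^^ k) u |k u. u \<in> B}" using that(2) B'(5) by simp
    qed (use gen[OF pq] in auto)
  qed
  then show ?thesis using B' by blast
qed

lemma dominant_finite_dim:
  assumes v: "highest_vector l v"
    and dom: "\<And>a. a \<in> {1..n} \<Longrightarrow> Suc a \<in> {1..n} \<Longrightarrow> \<omega> (\<gamma> a) (\<gamma> a) = \<omega> (\<gamma> (Suc a)) (\<gamma> (Suc a)) \<Longrightarrow>
      l a - l (Suc a) \<in> \<nat>"
  shows "finite_dim scale M"
proof -
  have vM: "v \<in> M" using v homog_in_M unfolding highest_vector_def weight_vector_def by blast
  define stable where "stable T B \<longleftrightarrow> finite B \<and> B \<subseteq> M \<and> v \<in> B \<and>
    (\<forall>p q u. (p, q) \<in> T \<longrightarrow> u \<in> span B \<longrightarrow> e p q u \<in> span B)" for T B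
  \<comment> \<open>Lowering units are filtered by \<open>c - a\<close>, which is additive under
    brackets; this supplies the ideals required by \<open>extend_stable\<close>.\<close>
  let ?T = "\<lambda>h. {(c, a). (c, a) \<in> lowering \<and> h \<le> c - a}"
  have fin: "finite lowering" by (rule finite_subset[OF lowering_subset]) simp
  have step: "\<exists>B. stable (?T h) B" if h: "h \<ge> 1" and B: "\<exists>B. stable (?T (Suc h)) B" for h
  proof -
    let ?L = "{(c, a). (c, a) \<in> lowering \<and> c - a = h}"
    have "finite ?L" by (rule finite_subset[OF _ fin]) auto
    moreover have "\<exists>B. stable (S \<union> ?T (Suc h)) B" if "finite S" "S \<subseteq> ?L" for S
      using that
    proof (induction S)
      case empty
      then show ?case using B by simp
    next
      case (insert x S)
      obtain c a where x: "x = (c, a)" by (cases x)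
      have ca: "(c, a) \<in> lowering" "c - a = h" using insert.prems x by auto
      obtain B where "stable (S \<union> ?T (Suc h)) B" using insert by auto
      then have B: "finite B" "B \<subseteq> M" "v \<in> B"
        "\<And>p q u. (p, q) \<in> S \<union> ?T (Suc h) \<Longrightarrow> u \<in> span B \<Longrightarrow> e p q u \<in> span B"
        unfolding stable_def by blast+
      have "\<exists>B'. finite B' \<and> B' \<subseteq> M \<and> B \<subseteq> B' \<and>
        (\<forall>p q u. (p, q) \<in> insert (c, a) (S \<union> ?T (Suc h)) \<longrightarrow> u \<in> span B' \<longrightarrow> e p q u \<in> span B')"
      proof (rule extend_stable[OF ca(1) _ B(1,2) nil_lowering[OF v dom ca(1)] B(4)])
        show "S \<union> ?T (Suc h) \<subseteq> lowering" using insert.prems by auto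
        fix p q assume "(p, q) \<in> S \<union> ?T (Suc h)"
        then have pq: "(p, q) \<in> lowering" "p - q \<ge> h" using insert.prems by auto
        \<comment> \<open>A bracket with \<open>E_ca\<close> has index difference at least
          \<open>2 h\<close>, hence above \<open>h\<close> because \<open>h \<ge> 1\<close>; it
          already lies in \<open>?T (Suc h)\<close>.\<close>
        show "(q = c \<longrightarrow> (p, a) \<in> S \<union> ?T (Suc h)) \<and> (a = p \<longrightarrow> (c, q) \<in> S \<union> ?T (Suc h))"
          using pq ca h by auto
      qed
      then obtain B' where "finite B'" "B' \<subseteq> M" "B \<subseteq> B'"
        "\<And>p q u. (p, q) \<in> insert (c, a) (S \<union> ?T (Suc h)) \<Longrightarrow> u \<in> span B' \<Longrightarrow> e p q u \<in> span B'"
        by blast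
      then have "stable (insert x S \<union> ?T (Suc h)) B'" using B(3) unfolding stable_def x by auto
      then show ?case ..
    qed
    ultimately have "\<exists>B. stable (?L \<union> ?T (Suc h)) B" by blast
    moreover have "?L \<union> ?T (Suc h) = ?T h" by auto
    ultimately show ?thesis by simp
  qed
  \<comment> \<open>Downward induction on the level: \<open>?T (Suc n)\<close> is empty, so
    \<open>{v}\<close> suffices at the start, and \<open>k = n\<close> reaches \<open>?T 1\<close>,
    which is all of \<open>lowering\<close>.\<close>
  have "\<exists>B. stable (?T (Suc n - k)) B" if "k \<le> n" for k
    using that
  proof (induction k)
    case 0
    then show ?case using vM by (intro exI[of _ "{v}"]) (auto simp: stable_def)
  next
    case (Suc k)
    then show ?case using step[of "Suc n - Suc k"] by (simp add: Suc_diff_le)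
  qed
  from this[of n] have "\<exists>B. stable (?T 1) B" by simp
  moreover have "?T 1 = lowering" by auto
  ultimately have "\<exists>B. stable lowering B" by (simp only:)
  then obtain B where "stable lowering B" ..
  then have B: "finite B" "B \<subseteq> M" "v \<in> B"
    "\<And>p q u. (p, q) \<in> lowering \<Longrightarrow> u \<in> span B \<Longrightarrow> e p q u \<in> span B"
    unfolding stable_def by blast+
  have "x \<in> span B" if "x \<in> words lowering v" for x
    using that
  proof induction
    case words_base
    then show ?case using B(3) by (rule span_base)
  next
    case (words_step x a c)
    then show ?case using B(4) by blast
  qed
  then have "M \<subseteq> span B"
    unfolding span_words_lowering[OF v, symmetric] by (intro span_minimal[OF _ subspace_span]) auto
  then have "span B = M" using span_minimal[OF B(2) M_subspace] by auto
  then show ?thesis using B(1) unfolding finite_dim_def by blast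
qed

section \<open>Existence of weight vectors and highest weight vectors\<close>

lemma weight_vector_exists:
  assumes B: "finite B" "M \<subseteq> span B"
  obtains l u where "weight_vector l u"
proof -
  obtain u0 where u0: "homog u0" "u0 \<noteq> 0" by (rule homog_nonzero_exists)
  obtain \<alpha> where \<alpha>: "u0 \<in> Mgr \<alpha>" using u0(1) unfolding homog_def by blast
  have sub: "subspace (Mgr \<alpha>)" using grading unfolding is_grading_def by blast
  \<comment> \<open>Diagonal units have degree 0, so the whole search can stay in one homogeneous
    component and ends with a homogeneous vector.\<close>
  have deg0: "e p p u \<in> Mgr \<alpha>" if "p \<in> {1..n}" "u \<in> Mgr \<alpha>" for p u
    using e_degree[OF that(1,1,2)] by simp
  have comm: "e p p (e q q u) = e q q (e p p u)" if "p \<in> {1..n}" "q \<in> {1..n}" "u \<in> M" for p q u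
    using e_diagonal_shift[OF that(1,2,2,3)] by simp
  \<comment> \<open>Joint eigenspaces are cut down one index at a time; stability under all diagonal
    units allows the next one to be restricted to \<open>W\<close>.\<close>
  have "\<exists>W l. subspace W \<and> W \<subseteq> Mgr \<alpha> \<and> W \<noteq> {0} \<and> (\<forall>p\<in>{1..n}. \<forall>u\<in>W. e p p u \<in> W) \<and>
      (\<forall>p\<in>{1..k}. \<forall>u\<in>W. e p p u = l p *s u)" if "k \<le> n" for k
    using that
  proof (induction k)
    case 0
    show ?case by (intro exI[of _ "Mgr \<alpha>"]) (use sub u0 \<alpha> deg0 in auto)
  next
    case (Suc k)
    obtain W l where W: "subspace W" "W \<subseteq> Mgr \<alpha>" "W \<noteq> {0}"
      and stab: "\<And>p u. p \<in> {1..n} \<Longrightarrow> u \<in> W \<Longrightarrow> e p p u \<in> W"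
      and l: "\<And>p u. p \<in> {1..k} \<Longrightarrow> u \<in> W \<Longrightarrow> e p p u = l p *s u"
      using Suc.IH[OF Suc_leD[OF Suc.prems]] by blast
    have k: "Suc k \<in> {1..n}" using Suc.prems by simp
    have WM: "W \<subseteq> M" using W(2) homog_in_M unfolding homog_def by blast
    interpret M: subspace_operator scale M "e (Suc k) (Suc k)" using k by (intro operator_e)
    interpret subspace_operator scale W "e (Suc k) (Suc k)"
      by unfold_locales (use W(1) subsetD[OF WM] stab[OF k] M.T_add M.T_scale in auto)
    have "W \<subseteq> span B" using WM B(2) by blast
    then obtain u d where u: "u \<in> W" "u \<noteq> 0" "e (Suc k) (Suc k) u = d *s u"
      using eigenvector_exists[OF B(1) _ W(3)] by blast
    let ?W = "{u \<in> W. e (Suc k) (Suc k) u = d *s u}"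
    have "subspace ?W"
    proof (rule subspaceI)
      show "0 \<in> ?W" using W(1) subspace_0 by (simp add: T_zero)
      show "x + y \<in> ?W" if "x \<in> ?W" "y \<in> ?W" for x y
        using that W(1) subspace_add by (simp add: T_add scale_right_distrib)
      show "k *s x \<in> ?W" if "x \<in> ?W" for k x
        using that W(1) subspace_scale by (simp add: T_scale scale_left_commute)
    qed
    \<comment> \<open>Diagonal units commute, so each preserves the eigenspaces of the
      others.\<close>
    moreover have "e p p w \<in> ?W" if p: "p \<in> {1..n}" and w: "w \<in> ?W" for p w
    proof -
      interpret p: subspace_operator scale M "e p p" using p by (intro operator_e)
      have "w \<in> M" using w WM by blast
      then show ?thesis using w stab[OF p] comm[OF k p] by (simp add: p.T_scale)
    qed
    moreover have "e p p w = (l(Suc k := d)) p *s w" if "p \<in> {1..Suc k}" "w \<in> ?W" for p w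
      using that l[of p w] by (cases "p = Suc k") auto
    ultimately show ?case
      using u W(2) by (intro exI[of _ ?W] exI[of _ "l(Suc k := d)"]) blast
  qed
  from this[OF order_refl] obtain W l where W: "subspace W" "W \<subseteq> Mgr \<alpha>" "W \<noteq> {0}"
    and l: "\<And>p u. p \<in> {1..n} \<Longrightarrow> u \<in> W \<Longrightarrow> e p p u = l p *s u" by blast
  obtain u where "u \<in> W" "u \<noteq> 0" using W(1,3) subspace_0 by blast
  then have "weight_vector l u" using W(2) l unfolding weight_vector_def homog_def by blast
  then show thesis by (rule that)
qed

text \<open>Heights of weight vectors are eigenvalues of one operator, hence finite in number; being
  complex, they are compared by real part. A nonzero image under a raising operator would exceed the
  maximum.\<close>

lemma highest_vector_exists:
  assumes B: "finite B" "M \<subseteq> span B"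
  obtains l v where "highest_vector l v"
proof -
  interpret subspace_operator scale M height_op by (rule operator_height)
  let ?H = "{height l |l u. weight_vector l u}"
  have "?H \<subseteq> {d. \<exists>u\<in>M. u \<noteq> 0 \<and> height_op u = d *s u}"
    using height_op_weight homog_in_M unfolding weight_vector_def by blast
  then have fin: "finite (Re ` ?H)" using finite_eigenvalues[OF B] finite_subset by blast
  obtain l0 u0 where "weight_vector l0 u0" using weight_vector_exists[OF B] .
  then have "Re ` ?H \<noteq> {}" by blast
  then have "Max (Re ` ?H) \<in> Re ` ?H" using fin by (rule Max_in[rotated])
  then obtain l v where v: "weight_vector l v" "Re (height l) = Max (Re ` ?H)" by auto
  have vM: "v \<in> M" using v(1) homog_in_M unfolding weight_vector_def by blast
  have "e a c v = 0" if a: "a \<in> {1..n}" and c: "c \<in> {1..n}" and "a < c" for a c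
  proof (rule ccontr)
    assume nz: "e a c v \<noteq> 0"
    obtain l' where l': "weight_vector l' (e a c v)" using weight_vector_shift[OF a c v(1) nz] ..
    have "height l' *s e a c v = (height l + of_nat c - of_nat a) *s e a c v"
      by (rule trans[OF height_op_weight[OF l', symmetric] height_op_shift[OF a c vM height_op_weight[OF v(1)]]])
    then have "height l' = height l + of_nat c - of_nat a" using nz unfolding scale_cancel_right by blast
    then have "Re (height l') > Re (height l)" using \<open>a < c\<close> by simp
    moreover have "Re (height l') \<le> Max (Re ` ?H)" using l' fin by (intro Max_ge) auto
    ultimately show False using v(2) by simp
  qed
  then have "highest_vector l v" using v(1) unfolding highest_vector_def by blast
  then show thesis by (rule that)
qed

end

section \<open>Matrix units with respect to a homogeneous basis\<close>

text \<open>Serves to identify the even indices with an initial segment whose length is the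
  dimension of the even part.\<close>

lemma downward_closed_nat_set:
  fixes S :: "nat set"
  assumes "S \<subseteq> {1..n}" and down: "\<And>a c. a \<in> {1..n} \<Longrightarrow> a \<le> c \<Longrightarrow> c \<in> S \<Longrightarrow> a \<in> S"
  shows "S = {1..card S}"
proof (cases "S = {}")
  case False
  have fin: "finite S" using assms(1) finite_subset by blast
  have mx: "Max S \<in> S" by (rule Max_in[OF fin False])
  have "S = {1..Max S}"
  proof
    show "S \<subseteq> {1..Max S}" using assms(1) Max_ge[OF fin] by auto
    show "{1..Max S} \<subseteq> S"
    proof
      fix a assume "a \<in> {1..Max S}"
      moreover have "Max S \<le> n" using mx assms(1) by auto
      ultimately show "a \<in> S" using down[OF _ _ mx, of a] by auto
    qed
  qed
  then show ?thesis by (metis card_atLeastAtMost diff_Suc_1 One_nat_def)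
qed simp

locale graded_basis = vector_space scaleV
  for scaleV :: "complex \<Rightarrow> 'v \<Rightarrow> 'v::ab_group_add" (infixr "*v" 75) +
  fixes \<omega> :: "'g::ab_group_add \<Rightarrow> 'g \<Rightarrow> complex"
    and V :: "'g \<Rightarrow> 'v set" and r :: "'g rel" and b :: "nat \<Rightarrow> 'v" and \<gamma> :: "nat \<Rightarrow> 'g"
  assumes omega: "commutative_factor \<omega>"
    and grading: "is_grading scaleV V UNIV"
    and order: "distinguished_order \<omega> V r"
    and basis: "homogeneous_basis scaleV V r b \<gamma>"
begin

abbreviation n :: nat where "n \<equiv> dim_total scaleV"

abbreviation E :: "nat \<Rightarrow> nat \<Rightarrow> 'v \<Rightarrow> 'v" where "E \<equiv> matrix_unit scaleV b"

definition coord :: "'v \<Rightarrow> nat \<Rightarrow> complex" where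
  "coord v a = representation (b ` {1..n}) v (b a)"

lemma inj_b: "inj_on b {1..n}"
  and independent_b: "independent (b ` {1..n})"
  and span_b: "span (b ` {1..n}) = UNIV"
  and degree_b: "a \<in> {1..n} \<Longrightarrow> b a \<in> V (\<gamma> a)"
  and gamma_mono: "a \<in> {1..n} \<Longrightarrow> c \<in> {1..n} \<Longrightarrow> a \<le> c \<Longrightarrow> (\<gamma> a, \<gamma> c) \<in> r"
  using basis unfolding homogeneous_basis_def by blast+

lemma in_span_b: "v \<in> span (b ` {1..n})"
  unfolding span_b by simp

lemma coord_add: "coord (u + v) a = coord u a + coord v a"
  unfolding coord_def representation_add[OF independent_b in_span_b in_span_b] ..

lemma coord_scale: "coord (k *v v) a = k * coord v a"
  unfolding coord_def representation_scale[OF independent_b in_span_b] ..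

lemma coord_zero: "coord 0 a = 0"
  unfolding coord_def by (simp add: representation_zero)

lemma coord_sum: "coord (sum f F) a = (\<Sum>i\<in>F. coord (f i) a)"
  by (induction F rule: infinite_finite_induct) (auto simp: coord_zero coord_add)

lemma coord_b: "a \<in> {1..n} \<Longrightarrow> c \<in> {1..n} \<Longrightarrow> coord (b c) a = (if a = c then 1 else 0)"
  unfolding coord_def representation_basis[OF independent_b imageI, of c]
  using inj_on_eq_iff[OF inj_b] by auto

lemma coord_expansion: "v = (\<Sum>a\<in>{1..n}. coord v a *v b a)"
proof -
  have "(\<Sum>x\<in>b ` {1..n}. representation (b ` {1..n}) v x *v x) = v"
    by (rule sum_representation_eq[OF independent_b in_span_b]) auto
  then show ?thesis unfolding coord_def sum.reindex[OF inj_b] comp_def by (rule sym)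
qed

lemma subspace_V: "subspace (V \<alpha>)"
  by (rule is_grading_subspaceD[OF grading])

text \<open>Grouping the basis expansion of \<open>v\<close> by degree and comparing with
  \<open>v\<close> itself, directness of the grading kills every part outside degree
  \<open>\<beta>\<close>.\<close>

lemma coord_homogeneous:
  assumes v: "v \<in> V \<beta>" and a: "a \<in> {1..n}" and ne: "\<gamma> a \<noteq> \<beta>"
  shows "coord v a = 0"
proof -
  let ?part = "\<lambda>\<alpha>. \<Sum>c\<in>{c\<in>{1..n}. \<gamma> c = \<alpha>}. coord v c *v b c"
  \<comment> \<open>Subtracting \<open>v\<close> in degree \<open>\<beta>\<close> turns the
    expansion into a family of homogeneous vectors with sum zero.\<close>
  let ?x = "\<lambda>\<alpha>. if \<alpha> = \<beta> then ?part \<alpha> - v else ?part \<alpha>"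
  let ?A = "insert \<beta> (\<gamma> ` {1..n})"
  have part: "?part \<alpha> \<in> V \<alpha>" for \<alpha>
    using degree_b by (intro subspace_sum[OF subspace_V] subspace_scale[OF subspace_V]) auto
  then have "\<forall>\<alpha>\<in>?A. ?x \<alpha> \<in> V \<alpha>" using v by (auto intro: subspace_diff[OF subspace_V])
  moreover have "sum ?x ?A = 0"
  proof -
    have "sum ?x ?A = (\<Sum>\<alpha>\<in>?A. ?part \<alpha> - (if \<alpha> = \<beta> then v else 0))"
      by (intro sum.cong) auto
    also have "\<dots> = sum ?part ?A - v" by (simp add: sum_subtractf)
    also have "sum ?part ?A = (\<Sum>c\<in>{1..n}. coord v c *v b c)"
      by (rule sum.group) auto
    also have "\<dots> = v" by (rule coord_expansion[symmetric])
    finally show ?thesis by simp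
  qed
  ultimately have "\<forall>\<alpha>\<in>?A. ?x \<alpha> = 0"
    by (intro is_grading_sum_zeroD[OF grading]) auto
  then have "?x (\<gamma> a) = 0" using a by blast
  then have "?part (\<gamma> a) = 0" using ne by (simp only: if_False)
  then have "0 = coord (?part (\<gamma> a)) a" by (simp only: coord_zero)
  also have "\<dots> = (\<Sum>c\<in>{c\<in>{1..n}. \<gamma> c = \<gamma> a}. if c = a then coord v a else 0)"
    unfolding coord_sum coord_scale using a by (intro sum.cong) (auto simp: coord_b)
  also have "\<dots> = coord v a" using a by simp
  finally show ?thesis by simp
qed

section \<open>Linear maps of \<open>V\<close> in terms of matrix units\<close>

lemma E_apply: "E a c v = coord v c *v b a"
  unfolding matrix_unit_def coord_def ..

lemma gl_iff: "X \<in> gl scaleV \<longleftrightarrow> (\<forall>u v. X (u + v) = X u + X v) \<and> (\<forall>k v. X (k *v v) = k *v X v)"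
  unfolding gl_def mem_Collect_eq Vector_Spaces.linear_iff by (simp add: vector_space_axioms)

lemma E_gl: "E a c \<in> gl scaleV"
  unfolding gl_iff E_apply by (simp add: coord_add coord_scale scale_left_distrib)

lemma gl_sum:
  assumes "X \<in> gl scaleV"
  shows "X (sum f F) = (\<Sum>i\<in>F. X (f i))"
proof (induction F rule: infinite_finite_induct)
  have "X (0 *v 0) = 0 *v X 0" using assms unfolding gl_iff by blast
  then have "X 0 = 0" by simp
  then show "X (sum f {}) = (\<Sum>i\<in>{}. X (f i))" "infinite A \<Longrightarrow> X (sum f A) = (\<Sum>i\<in>A. X (f i))" for A
    by simp_all
  show "X (sum f (insert x F)) = (\<Sum>i\<in>insert x F. X (f i))"
    if "finite F" "x \<notin> F" "X (sum f F) = (\<Sum>i\<in>F. X (f i))" for x F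
    using that assms unfolding gl_iff by simp
qed

lemma gl_matrix_expansion:
  assumes X: "X \<in> gl scaleV"
  shows "X = (\<lambda>v. \<Sum>(a, c)\<in>{1..n} \<times> {1..n}. coord (X (b c)) a *v E a c v)"
proof
  fix v
  have "X v = X (\<Sum>c\<in>{1..n}. coord v c *v b c)" using coord_expansion[of v] by (rule arg_cong)
  also have "\<dots> = (\<Sum>c\<in>{1..n}. coord v c *v X (b c))"
    unfolding gl_sum[OF X] using X unfolding gl_iff by simp
  also have "\<dots> = (\<Sum>c\<in>{1..n}. \<Sum>a\<in>{1..n}. coord (X (b c)) a *v E a c v)"
  proof (intro sum.cong refl)
    fix c
    have "coord v c *v X (b c) = coord v c *v (\<Sum>a\<in>{1..n}. coord (X (b c)) a *v b a)"
      using coord_expansion[of "X (b c)"] by (rule arg_cong)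
    then show "coord v c *v X (b c) = (\<Sum>a\<in>{1..n}. coord (X (b c)) a *v E a c v)"
      unfolding scale_sum_right E_apply by (simp only: scale_scale mult.commute)
  qed
  also have "\<dots> = (\<Sum>a\<in>{1..n}. \<Sum>c\<in>{1..n}. coord (X (b c)) a *v E a c v)"
    by (rule sum.swap)
  also have "\<dots> = (\<Sum>(a, c)\<in>{1..n} \<times> {1..n}. coord (X (b c)) a *v E a c v)"
    by (rule sum.cartesian_product)
  finally show "X v = (\<Sum>(a, c)\<in>{1..n} \<times> {1..n}. coord (X (b c)) a *v E a c v)" .
qed

lemma E_degree:
  assumes a: "a \<in> {1..n}" and c: "c \<in> {1..n}"
  shows "E a c \<in> gl_deg scaleV V (\<gamma> a - \<gamma> c)"
proof -
  have "E a c v \<in> V (\<gamma> a - \<gamma> c + \<beta>)" if "v \<in> V \<beta>" for v \<beta>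
  proof (cases "\<gamma> c = \<beta>")
    case True
    then show ?thesis using subspace_scale[OF subspace_V degree_b[OF a]] by (simp add: E_apply)
  next
    case False
    then show ?thesis using coord_homogeneous[OF that c] subspace_0[OF subspace_V] by (simp add: E_apply)
  qed
  then show ?thesis unfolding gl_deg_def using E_gl by auto
qed

lemma E_mult:
  assumes "c \<in> {1..n}" "p \<in> {1..n}"
  shows "E a c (E p q v) = (if c = p then 1 else 0) *v E a q v"
  using coord_b[OF assms] by (simp add: E_apply coord_scale)

lemma E_bracket:
  assumes "a \<in> {1..n}" "c \<in> {1..n}" "p \<in> {1..n}" "q \<in> {1..n}"
  shows "bracket \<omega> scaleV \<alpha> \<beta> (E a c) (E p q) =
    (\<lambda>v. (if c = p then 1 else 0) *v E a q v + (if q = a then - \<omega> \<alpha> \<beta> else 0) *v E p c v)"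
  unfolding bracket_def E_mult[OF assms(2,3)] E_mult[OF assms(4,1)] by auto

section \<open>The parity blocks of basis indices\<close>

abbreviation even_index :: "nat \<Rightarrow> bool" where "even_index a \<equiv> \<omega> (\<gamma> a) (\<gamma> a) = 1"

text \<open>An odd \<open>a\<close> before an even \<open>c\<close> would put
  \<open>\<gamma> c\<close> before \<open>\<gamma> a\<close> by distinguishedness and
  \<open>\<gamma> a\<close> before \<open>\<gamma> c\<close> by the ordering of the basis, so the
  degrees would coincide.\<close>

lemma even_index_mono:
  assumes a: "a \<in> {1..n}" and c: "c \<in> {1..n}" and ac: "a \<le> c" and even: "even_index c"
  shows "even_index a"
proof (rule ccontr)
  assume odd: "\<not> even_index a"
  \<comment> \<open>The distinguished order only relates degrees with nonzero component; basis
    vectors witness this.\<close>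
  have R: "\<gamma> p \<in> Gamma_R V" if "p \<in> {1..n}" for p
  proof -
    have "coord (b p) p \<noteq> coord 0 p" using coord_b[OF that that] by (simp add: coord_zero)
    then have "b p \<noteq> 0" by auto
    then show ?thesis using degree_b[OF that] unfolding Gamma_R_def by blast
  qed
  have "\<gamma> c \<in> Gamma_plus \<omega>" "\<gamma> a \<in> Gamma_minus \<omega>"
    using even odd cf_self[OF omega, of "\<gamma> a"] unfolding Gamma_plus_def Gamma_minus_def by auto
  then have "(\<gamma> c, \<gamma> a) \<in> r" using order R[OF a] R[OF c] unfolding distinguished_order_def by blast
  moreover have "antisym r"
    using order unfolding distinguished_order_def linear_order_on_def partial_order_on_def by blast
  ultimately have "\<gamma> a = \<gamma> c" using gamma_mono[OF a c ac] by (simp add: antisym_def)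
  then show False using even odd by simp
qed

text \<open>A vector of even degree has nonzero coordinates only at indices of the same degree, so
  the even basis vectors form a basis of the even part.\<close>

lemma M_plus_eq: "M_plus \<omega> scaleV V = card {a\<in>{1..n}. even_index a}"
proof -
  let ?P = "{a\<in>{1..n}. even_index a}"
  have "span (\<Union>\<alpha>\<in>Gamma_plus \<omega>. V \<alpha>) = span (b ` ?P)"
  proof
    show "span (b ` ?P) \<subseteq> span (\<Union>\<alpha>\<in>Gamma_plus \<omega>. V \<alpha>)"
      using degree_b unfolding Gamma_plus_def by (intro span_mono) auto
    have "v \<in> span (b ` ?P)" if v: "v \<in> V \<alpha>" and \<alpha>: "\<alpha> \<in> Gamma_plus \<omega>" for v \<alpha>
    proof -
      have "coord v a *v b a \<in> span (b ` ?P)" if a: "a \<in> {1..n}" for a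
      proof (cases "\<gamma> a = \<alpha>")
        case True
        then show ?thesis using a \<alpha> unfolding Gamma_plus_def by (intro span_scale span_base) auto
      next
        case False
        then show ?thesis using coord_homogeneous[OF v a] by (simp add: span_zero)
      qed
      then have "(\<Sum>a\<in>{1..n}. coord v a *v b a) \<in> span (b ` ?P)" by (rule span_sum)
      then show ?thesis unfolding coord_expansion[of v, symmetric] .
    qed
    then show "span (\<Union>\<alpha>\<in>Gamma_plus \<omega>. V \<alpha>) \<subseteq> span (b ` ?P)"
      by (intro span_minimal[OF _ subspace_span]) blast
  qed
  moreover have "independent (b ` ?P)" by (rule independent_mono[OF independent_b]) blast
  moreover have "card (b ` ?P) = card ?P" by (rule card_image[OF inj_on_subset[OF inj_b]]) blast
  ultimately show ?thesis unfolding M_plus_def by (simp add: dim_eq_card_independent)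
qed

lemma even_index_iff:
  assumes "a \<in> {1..n}"
  shows "even_index a \<longleftrightarrow> a \<le> M_plus \<omega> scaleV V"
proof -
  have "{a\<in>{1..n}. even_index a} = {1..M_plus \<omega> scaleV V}"
    unfolding M_plus_eq
  proof (rule downward_closed_nat_set)
    show "a \<in> {a\<in>{1..n}. even_index a}"
      if "a \<in> {1..n}" "a \<le> c" "c \<in> {a\<in>{1..n}. even_index a}" for a c
      using even_index_mono[OF that(1) _ that(2)] that(1,3) by blast
  qed blast
  then have "a \<in> {a\<in>{1..n}. even_index a} \<longleftrightarrow> a \<in> {1..M_plus \<omega> scaleV V}" by simp
  then show ?thesis using assms by simp
qed

section \<open>Roots, the bilinear form and dominance\<close>

lemma eps_E: "a \<in> {1..n} \<Longrightarrow> p \<in> {1..n} \<Longrightarrow> eps scaleV b a (E p p) = (if a = p then 1 else 0)"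
  using coord_b[of a p] coord_b[of p a] unfolding eps_def coord_def[symmetric]
  by (simp add: E_apply coord_scale)

lemma weight_form_root:
  assumes a: "a \<in> {1..n}" and c: "c \<in> {1..n}"
  shows "weight_form \<omega> scaleV b \<gamma> l (\<lambda>H. eps scaleV b a H - eps scaleV b c H) =
    \<omega> (\<gamma> a) (\<gamma> a) * l (E a a) - \<omega> (\<gamma> c) (\<gamma> c) * l (E c c)"
proof -
  have "weight_form \<omega> scaleV b \<gamma> l (\<lambda>H. eps scaleV b a H - eps scaleV b c H) =
    (\<Sum>p\<in>{1..n}. (if p = a then \<omega> (\<gamma> p) (\<gamma> p) * l (E p p) else 0)
      - (if p = c then \<omega> (\<gamma> p) (\<gamma> p) * l (E p p) else 0))"
    unfolding weight_form_def
  proof (intro sum.cong refl)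
    fix p assume p: "p \<in> {1..n}"
    show "\<omega> (\<gamma> p) (\<gamma> p) * l (E p p) * (eps scaleV b a (E p p) - eps scaleV b c (E p p)) =
      (if p = a then \<omega> (\<gamma> p) (\<gamma> p) * l (E p p) else 0) - (if p = c then \<omega> (\<gamma> p) (\<gamma> p) * l (E p p) else 0)"
      unfolding eps_E[OF a p] eps_E[OF c p] by auto
  qed
  then show ?thesis using a c by (simp add: sum_subtractf)
qed

text \<open>Within a parity block both coordinates carry the same sign, which cancels between
  numerator and denominator.\<close>

lemma root_ratio:
  assumes a: "a \<in> {1..n}" and c: "c \<in> {1..n}" and ne: "a \<noteq> c"
    and even: "\<omega> (\<gamma> a) (\<gamma> a) = \<omega> (\<gamma> c) (\<gamma> c)"
  defines "\<Upsilon> \<equiv> \<lambda>H. eps scaleV b a H - eps scaleV b c H"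
  shows "2 * weight_form \<omega> scaleV b \<gamma> l \<Upsilon> / weight_form \<omega> scaleV b \<gamma> \<Upsilon> \<Upsilon> = l (E a a) - l (E c c)"
proof -
  have "\<Upsilon> (E a a) = 1" "\<Upsilon> (E c c) = -1"
    using ne unfolding \<Upsilon>_def eps_E[OF a a] eps_E[OF c a] eps_E[OF a c] eps_E[OF c c] by auto
  then have "weight_form \<omega> scaleV b \<gamma> \<Upsilon> \<Upsilon> = 2 * \<omega> (\<gamma> c) (\<gamma> c)"
    using weight_form_root[OF a c, of \<Upsilon>] even unfolding \<Upsilon>_def[symmetric] by simp
  moreover have "weight_form \<omega> scaleV b \<gamma> l \<Upsilon> = \<omega> (\<gamma> c) (\<gamma> c) * (l (E a a) - l (E c c))"
    using weight_form_root[OF a c, of l] even unfolding \<Upsilon>_def[symmetric] by (simp add: algebra_simps)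
  ultimately show ?thesis using cf_nonzero[OF omega] by simp
qed

lemma Lambda_dom_iff:
  assumes "l \<in> cartan_dual scaleV b"
  shows "l \<in> Lambda_dom \<omega> scaleV V b \<gamma> \<longleftrightarrow>
    (\<forall>a\<in>{1..n}. \<forall>c\<in>{1..n}. a < c \<longrightarrow> \<omega> (\<gamma> a) (\<gamma> a) = \<omega> (\<gamma> c) (\<gamma> c) \<longrightarrow> l (E a a) - l (E c c) \<in> \<nat>)"
proof -
  let ?root = "\<lambda>a c H. eps scaleV b a H - eps scaleV b c H"
  have M: "M_plus \<omega> scaleV V \<le> n"
  proof -
    have "card {a\<in>{1..n}. even_index a} \<le> card {1..n}" by (rule card_mono) auto
    then show ?thesis unfolding M_plus_eq by simp
  qed
  have same: "(\<omega> (\<gamma> a) (\<gamma> a) = \<omega> (\<gamma> c) (\<gamma> c)) \<longleftrightarrow> (even_index a \<longleftrightarrow> even_index c)" for a c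
    using cf_self[OF omega, of "\<gamma> a"] cf_self[OF omega, of "\<gamma> c"] by auto
  \<comment> \<open>The two index ranges in \<open>Phi0_plus\<close> are the even and the odd block,
    so its roots are those joining indices of equal parity.\<close>
  have "Phi0_plus \<omega> scaleV V b = {?root a c |a c. a \<in> {1..n} \<and> c \<in> {1..n} \<and> a < c \<and>
      \<omega> (\<gamma> a) (\<gamma> a) = \<omega> (\<gamma> c) (\<gamma> c)}" (is "_ = ?R")
  proof
    show "Phi0_plus \<omega> scaleV V b \<subseteq> ?R"
    proof
      fix \<Upsilon> assume "\<Upsilon> \<in> Phi0_plus \<omega> scaleV V b"
      then obtain a c where \<Upsilon>: "\<Upsilon> = ?root a c" and ac: "a < c"
        "1 \<le> a \<and> c \<le> M_plus \<omega> scaleV V \<or> M_plus \<omega> scaleV V < a \<and> c \<le> n"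
        unfolding Phi0_plus_def by blast
      then have i: "a \<in> {1..n}" "c \<in> {1..n}" using M by auto
      have "even_index a \<longleftrightarrow> even_index c" unfolding even_index_iff[OF i(1)] even_index_iff[OF i(2)]
        using ac by auto
      then show "\<Upsilon> \<in> ?R" using \<Upsilon> i ac(1) same by blast
    qed
    show "?R \<subseteq> Phi0_plus \<omega> scaleV V b"
    proof
      fix \<Upsilon> assume "\<Upsilon> \<in> ?R"
      then obtain a c where \<Upsilon>: "\<Upsilon> = ?root a c" and i: "a \<in> {1..n}" "c \<in> {1..n}" and ac: "a < c"
        and eq: "\<omega> (\<gamma> a) (\<gamma> a) = \<omega> (\<gamma> c) (\<gamma> c)" by blast
      have "a \<le> M_plus \<omega> scaleV V \<longleftrightarrow> c \<le> M_plus \<omega> scaleV V"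
        using eq even_index_iff[OF i(1)] even_index_iff[OF i(2)] by auto
      then have "1 \<le> a \<and> a < c \<and> c \<le> M_plus \<omega> scaleV V \<or> M_plus \<omega> scaleV V < a \<and> a < c \<and> c \<le> n"
        using i ac by auto
      then show "\<Upsilon> \<in> Phi0_plus \<omega> scaleV V b" unfolding Phi0_plus_def \<Upsilon> by blast
    qed
  qed
  then have "l \<in> Lambda_dom \<omega> scaleV V b \<gamma> \<longleftrightarrow> (\<forall>\<Upsilon>\<in>?R. 2 * weight_form \<omega> scaleV b \<gamma> l \<Upsilon> / weight_form \<omega> scaleV b \<gamma> \<Upsilon> \<Upsilon> \<in> \<nat>)"
    using assms unfolding Lambda_dom_def by simp
  also have "\<dots> \<longleftrightarrow> (\<forall>a c. a \<in> {1..n} \<and> c \<in> {1..n} \<and> a < c \<and> \<omega> (\<gamma> a) (\<gamma> a) = \<omega> (\<gamma> c) (\<gamma> c) \<longrightarrow>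
      2 * weight_form \<omega> scaleV b \<gamma> l (?root a c) / weight_form \<omega> scaleV b \<gamma> (?root a c) (?root a c) \<in> \<nat>)"
    by blast
  also have "\<dots> \<longleftrightarrow> (\<forall>a c. a \<in> {1..n} \<and> c \<in> {1..n} \<and> a < c \<and> \<omega> (\<gamma> a) (\<gamma> a) = \<omega> (\<gamma> c) (\<gamma> c) \<longrightarrow>
      l (E a a) - l (E c c) \<in> \<nat>)"
    by (intro iff_allI imp_cong refl) (elim conjE, subst root_ratio, assumption, assumption, erule less_imp_neq, assumption, rule refl)
  also have "\<dots> \<longleftrightarrow> (\<forall>a\<in>{1..n}. \<forall>c\<in>{1..n}. a < c \<longrightarrow> \<omega> (\<gamma> a) (\<gamma> a) = \<omega> (\<gamma> c) (\<gamma> c) \<longrightarrow> l (E a a) - l (E c c) \<in> \<nat>)"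
    by blast
  finally show ?thesis .
qed

end

section \<open>From modules over the general linear algebra to matrix units\<close>

locale simple_graded_module = graded_basis scaleV \<omega> V r b \<gamma> + M: vector_space scaleM
  for scaleV :: "complex \<Rightarrow> 'v \<Rightarrow> 'v::ab_group_add" (infixr "*v" 75)
    and \<omega> :: "'g::ab_group_add \<Rightarrow> 'g \<Rightarrow> complex"
    and V :: "'g \<Rightarrow> 'v set" and r :: "'g rel" and b :: "nat \<Rightarrow> 'v" and \<gamma> :: "nat \<Rightarrow> 'g"
    and scaleM :: "complex \<Rightarrow> 'm \<Rightarrow> 'm::ab_group_add" (infixr "*s" 75) +
  fixes M :: "'m set" and Mgr :: "'g \<Rightarrow> 'm set" and act :: "('v \<Rightarrow> 'v) \<Rightarrow> 'm \<Rightarrow> 'm"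
  assumes simple_module: "simple_gl_module \<omega> scaleV V scaleM M Mgr act"
begin

lemma gl_module: "gl_module \<omega> scaleV V scaleM M Mgr act"
  using simple_module unfolding simple_gl_module_def by (elim conjE)

lemma M_subspace: "M.subspace M"
  using gl_module unfolding gl_module_def by (elim conjE)

lemma M_grading: "is_grading scaleM Mgr M"
  using gl_module unfolding gl_module_def by (elim conjE)

lemma act_closed: "X \<in> gl scaleV \<Longrightarrow> u \<in> M \<Longrightarrow> act X u \<in> M"
  using gl_module unfolding gl_module_def by (elim conjE) simp

lemma act_add: "X \<in> gl scaleV \<Longrightarrow> u \<in> M \<Longrightarrow> w \<in> M \<Longrightarrow> act X (u + w) = act X u + act X w"
  using gl_module unfolding gl_module_def by (elim conjE) simp

lemma act_scale: "X \<in> gl scaleV \<Longrightarrow> u \<in> M \<Longrightarrow> act X (k *s u) = k *s act X u"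
  using gl_module unfolding gl_module_def by (elim conjE) simp

lemma act_add_left:
  "X \<in> gl scaleV \<Longrightarrow> Y \<in> gl scaleV \<Longrightarrow> u \<in> M \<Longrightarrow> act (\<lambda>v. X v + Y v) u = act X u + act Y u"
  using gl_module unfolding gl_module_def by (elim conjE) simp

lemma act_scale_left: "X \<in> gl scaleV \<Longrightarrow> u \<in> M \<Longrightarrow> act (\<lambda>v. k *v X v) u = k *s act X u"
  using gl_module unfolding gl_module_def by (elim conjE) simp

lemma act_degree: "X \<in> gl_deg scaleV V \<alpha> \<Longrightarrow> u \<in> Mgr \<beta> \<Longrightarrow> act X u \<in> Mgr (\<alpha> + \<beta>)"
  using gl_module unfolding gl_module_def by (elim conjE) simp

lemma act_bracket:
  "X \<in> gl_deg scaleV V \<alpha> \<Longrightarrow> Y \<in> gl_deg scaleV V \<beta> \<Longrightarrow> u \<in> M \<Longrightarrow>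
    act X (act Y u) - \<omega> \<alpha> \<beta> *s act Y (act X u) = act (bracket \<omega> scaleV \<alpha> \<beta> X Y) u"
  using gl_module unfolding gl_module_def by (elim conjE) simp

lemma scaled_gl: "X \<in> gl scaleV \<Longrightarrow> (\<lambda>v. k *v X v) \<in> gl scaleV"
  unfolding gl_iff by (simp add: scale_right_distrib mult.commute)

text \<open>The action is additive only in arguments from \<open>gl scaleV\<close>, so membership of
  the partial sums is proved along with the formula.\<close>

lemma act_sum_left:
  assumes "finite F" "\<And>i. i \<in> F \<Longrightarrow> X i \<in> gl scaleV" "u \<in> M"
  shows "(\<lambda>v. \<Sum>i\<in>F. k i *v X i v) \<in> gl scaleV \<and>
    act (\<lambda>v. \<Sum>i\<in>F. k i *v X i v) u = (\<Sum>i\<in>F. k i *s act (X i) u)"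
  using assms(1,2)
proof (induction F)
  case empty
  \<comment> \<open>The empty sum is the zero map, treated as 0 times the identity so that
    homogeneity of the action applies.\<close>
  have "(\<lambda>v. v) \<in> gl scaleV" unfolding gl_iff by simp
  then have "act (\<lambda>v. 0 *v v) u = 0 *s act (\<lambda>v. v) u" using assms(3) by (rule act_scale_left)
  then show ?case unfolding gl_iff by simp
next
  case (insert x F)
  let ?S = "\<lambda>v. \<Sum>i\<in>F. k i *v X i v"
  have S: "?S \<in> gl scaleV" "act ?S u = (\<Sum>i\<in>F. k i *s act (X i) u)" using insert by auto
  have x: "X x \<in> gl scaleV" using insert.prems by simp
  have "act (\<lambda>v. k x *v X x v + ?S v) u = k x *s act (X x) u + act ?S u"
    using act_add_left[OF scaled_gl[OF x] S(1) assms(3)] act_scale_left[OF x assms(3)] by simp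
  moreover have "(\<lambda>v. k x *v X x v + ?S v) \<in> gl scaleV"
    using scaled_gl[OF x, of "k x"] S(1) unfolding gl_iff by (simp add: scale_right_distrib algebra_simps del: scale_left_commute)
  ultimately show ?case using insert.hyps S(2) by simp
qed

lemma act_expansion:
  assumes "X \<in> gl scaleV" "u \<in> M"
  shows "act X u = (\<Sum>(a, c)\<in>{1..n} \<times> {1..n}. coord (X (b c)) a *s act (E a c) u)"
  using act_sum_left[of "{1..n} \<times> {1..n}" "\<lambda>(a, c). E a c" u "\<lambda>(a, c). coord (X (b c)) a"] E_gl assms(2)
    gl_matrix_expansion[OF assms(1)]
  by (simp add: case_prod_beta)

sublocale S: simple_color_module scaleM \<omega> \<gamma> n M Mgr "\<lambda>a c. act (E a c)"
proof
  show "commutative_factor \<omega>" by (rule omega)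
  show "M.subspace M" by (rule M_subspace)
  show "is_grading scaleM Mgr M" by (rule M_grading)
  show "M \<noteq> {0}" using simple_module unfolding simple_gl_module_def by (elim conjE)
  show "even_index a" if "a \<in> {1..n}" "c \<in> {1..n}" "a \<le> c" "even_index c" for a c
    using that by (rule even_index_mono)
  show "act (E a c) u \<in> Mgr (\<gamma> a - \<gamma> c + \<beta>)" if "a \<in> {1..n}" "c \<in> {1..n}" "u \<in> Mgr \<beta>" for a c u \<beta>
    using E_degree[OF that(1,2)] that(3) by (rule act_degree)
  show "act (E a c) (act (E p q) u) = \<omega> (\<gamma> a - \<gamma> c) (\<gamma> p - \<gamma> q) *s act (E p q) (act (E a c) u) +
      ((if c = p then act (E a q) u else 0) -
       (if q = a then \<omega> (\<gamma> a - \<gamma> c) (\<gamma> p - \<gamma> q) *s act (E p c) u else 0))"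
    if i: "a \<in> {1..n}" "c \<in> {1..n}" "p \<in> {1..n}" "q \<in> {1..n}" and u: "u \<in> M" for a c p q u
  proof -
    let ?w = "\<omega> (\<gamma> a - \<gamma> c) (\<gamma> p - \<gamma> q)"
    have "act (E a c) (act (E p q) u) - ?w *s act (E p q) (act (E a c) u) =
      (if c = p then 1 else 0) *s act (E a q) u + (if q = a then - ?w else 0) *s act (E p c) u"
      unfolding act_bracket[OF E_degree[OF i(1,2)] E_degree[OF i(3,4)] u] E_bracket[OF i]
        act_add_left[OF scaled_gl[OF E_gl] scaled_gl[OF E_gl] u] act_scale_left[OF E_gl u] ..
    also have "\<dots> = (if c = p then act (E a q) u else 0) - (if q = a then ?w *s act (E p c) u else 0)"
      by simp
    finally show ?thesis by (simp only: diff_eq_eq add.commute)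
  qed
  show "W = {0} \<or> W = M"
    if W: "W \<subseteq> M" "M.subspace W" "is_grading scaleM (\<lambda>\<alpha>. W \<inter> Mgr \<alpha>) W"
      and stable: "\<And>a c u. \<lbrakk>a \<in> {1..n}; c \<in> {1..n}; u \<in> W\<rbrakk> \<Longrightarrow> act (E a c) u \<in> W" for W
  proof -
    \<comment> \<open>Matrix units span all linear maps, so stability under them gives a submodule
      in the original sense.\<close>
    have "act X u \<in> W" if X: "X \<in> gl scaleV" and u: "u \<in> W" for X u
      unfolding act_expansion[OF X subsetD[OF W(1) u]]
      using stable u by (auto intro!: M.subspace_sum[OF W(2)] M.subspace_scale[OF W(2)])
    then have "gl_submodule scaleV scaleM M Mgr act W"
      using W unfolding gl_submodule_def by simp
    then show ?thesis using simple_module unfolding simple_gl_module_def by (elim conjE) simp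
  qed
qed (auto intro: act_closed act_add act_scale E_gl)

section \<open>Highest weight modules and highest weight vectors\<close>

lemma E_cartan:
  assumes "p \<in> {1..n}"
  shows "E p p \<in> cartan scaleV b"
proof -
  have "E p p v = (\<Sum>a\<in>{1..n}. (if a = p then 1 else 0) *v E a a v)" for v
  proof -
    have "(\<Sum>a\<in>{1..n}. (if a = p then 1 else 0) *v E a a v) = (\<Sum>a\<in>{1..n}. if a = p then E a a v else 0)"
      by (intro sum.cong) auto
    then show ?thesis using assms by simp
  qed
  then show ?thesis unfolding cartan_def by (intro CollectI exI ext)
qed

lemma E_nilradical:
  assumes "1 \<le> a" "a < c" "c \<le> n"
  shows "E a c \<in> nilradical scaleV b"
proof -
  let ?P = "{(i, j). 1 \<le> i \<and> i < j \<and> j \<le> n}"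
  let ?k = "\<lambda>i j. if (i, j) = (a, c) then 1 else (0 :: complex)"
  have fin: "finite ?P" by (rule finite_subset[of _ "{1..n} \<times> {1..n}"]) auto
  have "E a c v = (\<Sum>(i, j)\<in>?P. ?k i j *v E i j v)" for v
  proof -
    have "(\<Sum>(i, j)\<in>?P. ?k i j *v E i j v) = (\<Sum>x\<in>?P. if x = (a, c) then E a c v else 0)"
      by (intro sum.cong) (auto split: if_splits)
    also have "\<dots> = E a c v" using fin assms by (subst sum.delta) auto
    finally show ?thesis ..
  qed
  then show ?thesis unfolding nilradical_def by (intro CollectI exI ext)
qed

lemma highest_vector_of_highest_weight_module:
  assumes "highest_weight_module \<omega> scaleV V b scaleM M Mgr act l"
  obtains v where "S.highest_vector (\<lambda>p. l (E p p)) v"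
proof -
  obtain \<mu> v where v: "v \<in> Mgr \<mu>" "v \<noteq> 0" and n: "\<forall>X\<in>nilradical scaleV b. act X v = 0"
    and h: "\<forall>H\<in>cartan scaleV b. act H v = l H *s v"
    using assms unfolding highest_weight_module_def by auto
  have "S.highest_vector (\<lambda>p. l (E p p)) v"
    unfolding S.highest_vector_def S.weight_vector_def S.homog_def
  proof (intro conjI ballI impI)
    show "\<exists>\<mu>. v \<in> Mgr \<mu>" using v(1) by blast
    show "v \<noteq> 0" by (rule v(2))
    show "act (E p p) v = l (E p p) *s v" if "p \<in> {1..n}" for p
      using h E_cartan[OF that] by (rule bspec)
    show "act (E a c) v = 0" if "a \<in> {1..n}" "c \<in> {1..n}" "a < c" for a c
      using n E_nilradical[of a c] that by simp
  qed
  then show thesis by (rule that)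
qed

text \<open>The number \<open>coord (H (b a)) a\<close> is the \<open>a\<close>-th diagonal entry of
  \<open>H\<close>; the sum is thus the linear functional on the Cartan subalgebra with value
  \<open>l a\<close> at \<open>E_aa\<close>.\<close>

lemma act_cartan:
  assumes v: "S.highest_vector l v" and H: "H \<in> cartan scaleV b"
  shows "act H v = (\<Sum>a\<in>{1..n}. coord (H (b a)) a * l a) *s v"
proof -
  have vM: "v \<in> M" and wt: "\<And>a. a \<in> {1..n} \<Longrightarrow> act (E a a) v = l a *s v"
    using v S.homog_in_M unfolding S.highest_vector_def S.weight_vector_def by blast+
  obtain k where k: "H = (\<lambda>v. \<Sum>a\<in>{1..n}. k a *v E a a v)" using H unfolding cartan_def by blast
  have "coord (H (b a)) a = k a" if "a \<in> {1..n}" for a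
  proof -
    have "coord (H (b a)) a = (\<Sum>c\<in>{1..n}. if c = a then k a else 0)"
      unfolding k coord_sum coord_scale E_apply using that by (intro sum.cong) (auto simp: coord_b)
    then show ?thesis using that by simp
  qed
  then have "(\<Sum>a\<in>{1..n}. coord (H (b a)) a * l a) *s v = (\<Sum>a\<in>{1..n}. k a *s act (E a a) v)"
    unfolding M.scale_sum_left using wt by (intro sum.cong) simp_all
  then show ?thesis
    unfolding k using act_sum_left[of "{1..n}" "\<lambda>a. E a a" v k] E_gl vM by simp
qed

lemma act_nilradical:
  assumes v: "S.highest_vector l v" and X: "X \<in> nilradical scaleV b"
  shows "act X v = 0"
proof -
  let ?P = "{(i, j). 1 \<le> i \<and> i < j \<and> j \<le> n}"
  have fin: "finite ?P" by (rule finite_subset[of _ "{1..n} \<times> {1..n}"]) auto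
  have vM: "v \<in> M" using v S.homog_in_M unfolding S.highest_vector_def S.weight_vector_def by blast
  obtain k where k: "X = (\<lambda>v. \<Sum>(i, j)\<in>?P. k i j *v E i j v)"
    using X unfolding nilradical_def by blast
  have "act X v = (\<Sum>(i, j)\<in>?P. k i j *s act (E i j) v)"
    unfolding k using act_sum_left[OF fin, of "\<lambda>(i, j). E i j" v "\<lambda>(i, j). k i j"] E_gl vM
    by (simp add: case_prod_beta)
  also have "\<dots> = 0" using v unfolding S.highest_vector_def by (intro sum.neutral) auto
  finally show ?thesis .
qed

lemma finite_dim_highest_weight_module:
  assumes "finite_dim scaleM M"
  shows "\<exists>l\<in>cartan_dual scaleV b. highest_weight_module \<omega> scaleV V b scaleM M Mgr act l"
proof -
  obtain B where "finite B" "M \<subseteq> M.span B" using assms unfolding finite_dim_def by blast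
  then obtain l v where v: "S.highest_vector l v" by (rule S.highest_vector_exists)
  define \<Lambda> where "\<Lambda> H = (\<Sum>a\<in>{1..n}. coord (H (b a)) a * l a)" for H
  have "\<Lambda> \<in> cartan_dual scaleV b"
    unfolding cartan_dual_def \<Lambda>_def
    by (simp add: coord_add coord_scale sum.distrib distrib_right sum_distrib_left mult.assoc)
  moreover have "highest_weight_module \<omega> scaleV V b scaleM M Mgr act \<Lambda>"
    unfolding highest_weight_module_def
  proof (intro conjI)
    obtain \<mu> where \<mu>: "v \<in> Mgr \<mu>" and v0: "v \<noteq> 0" and vM: "v \<in> M"
      using v S.homog_in_M unfolding S.highest_vector_def S.weight_vector_def S.homog_def by blast
    have "Mgr \<alpha> \<subseteq> M" for \<alpha> by (rule is_grading_subset[OF M.vector_space_axioms M_grading])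
    then have "gl_submodule scaleV scaleM M Mgr act M"
      unfolding gl_submodule_def using M_subspace M_grading act_closed by (simp add: Int_absorb1)
    \<comment> \<open>By simplicity any submodule containing the nonzero vector \<open>v\<close> is
      everything, so \<open>v\<close> generates \<open>M\<close>.\<close>
    moreover have "W = M" if "gl_submodule scaleV scaleM M Mgr act W" "v \<in> W" for W
      using that v0 simple_module unfolding simple_gl_module_def by blast
    ultimately have "\<Inter>{W. gl_submodule scaleV scaleM M Mgr act W \<and> v \<in> W} = M" using vM by blast
    then show "\<exists>\<mu>. \<exists>v\<in>Mgr \<mu>. v \<noteq> 0 \<and> (\<forall>X\<in>nilradical scaleV b. act X v = 0) \<and>
        (\<forall>H\<in>cartan scaleV b. act H v = \<Lambda> H *s v) \<and>
        \<Inter>{W. gl_submodule scaleV scaleM M Mgr act W \<and> v \<in> W} = M"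
      using \<mu> v0 act_nilradical[OF v] act_cartan[OF v] unfolding \<Lambda>_def by blast
  qed (rule gl_module)
  ultimately show ?thesis by blast
qed

text \<open>Finite dimensionality gives integrality for every pair of equal parity, whereas the
  converse uses it for neighbouring indices only.\<close>

lemma finite_dim_iff_dominant:
  assumes l: "l \<in> cartan_dual scaleV b"
    and hw: "highest_weight_module \<omega> scaleV V b scaleM M Mgr act l"
  shows "finite_dim scaleM M \<longleftrightarrow> l \<in> Lambda_dom \<omega> scaleV V b \<gamma>"
proof -
  obtain v where v: "S.highest_vector (\<lambda>p. l (E p p)) v"
    using hw by (rule highest_vector_of_highest_weight_module)
  show ?thesis
    unfolding Lambda_dom_iff[OF l]
  proof
    assume "finite_dim scaleM M"
    then obtain B where "finite B" "M \<subseteq> M.span B" unfolding finite_dim_def by blast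
    then show "\<forall>a\<in>{1..n}. \<forall>c\<in>{1..n}. a < c \<longrightarrow> \<omega> (\<gamma> a) (\<gamma> a) = \<omega> (\<gamma> c) (\<gamma> c) \<longrightarrow>
        l (E a a) - l (E c c) \<in> \<nat>"
      using S.finite_dim_dominant[OF _ _ v] by blast
  next
    assume dom: "\<forall>a\<in>{1..n}. \<forall>c\<in>{1..n}. a < c \<longrightarrow> \<omega> (\<gamma> a) (\<gamma> a) = \<omega> (\<gamma> c) (\<gamma> c) \<longrightarrow>
        l (E a a) - l (E c c) \<in> \<nat>"
    show "finite_dim scaleM M"
      by (rule S.dominant_finite_dim[OF v]) (use dom in blast)
  qed
qed

end

theorem theorem3p6:
  fixes \<omega> :: "'g::ab_group_add \<Rightarrow> 'g \<Rightarrow> complex"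
    and scaleV :: "complex \<Rightarrow> 'v \<Rightarrow> 'v::ab_group_add"
    and V :: "'g \<Rightarrow> 'v set"
    and r :: "'g rel"
    and b :: "nat \<Rightarrow> 'v"
    and \<gamma> :: "nat \<Rightarrow> 'g"
    and scaleM :: "complex \<Rightarrow> 'm \<Rightarrow> 'm::ab_group_add"
  assumes "commutative_factor \<omega>"
    and "vector_space scaleV"
    and "finite_dim scaleV UNIV"
    and "is_grading scaleV V UNIV"
    and "distinguished_order \<omega> V r"
    and "homogeneous_basis scaleV V r b \<gamma>"
    and "vector_space scaleM"
  shows
    "(\<forall>M Mgr act.
        simple_gl_module \<omega> scaleV V scaleM M Mgr act \<longrightarrow> finite_dim scaleM M \<longrightarrow>
        (\<exists>l \<in> cartan_dual scaleV b. highest_weight_module \<omega> scaleV V b scaleM M Mgr act l)) \<and>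
     (\<forall>l \<in> cartan_dual scaleV b. \<forall>M Mgr act.
        is_L \<omega> scaleV V b scaleM M Mgr act l \<longrightarrow>
        (finite_dim scaleM M \<longleftrightarrow> l \<in> Lambda_dom \<omega> scaleV V b \<gamma>))"
proof -
  have module: "simple_graded_module scaleV \<omega> V r b \<gamma> scaleM M Mgr act"
    if "simple_gl_module \<omega> scaleV V scaleM M Mgr act" for M Mgr act
    by (intro simple_graded_module.intro graded_basis.intro graded_basis_axioms.intro
        simple_graded_module_axioms.intro assms that)
  show ?thesis
    using simple_graded_module.finite_dim_highest_weight_module[OF module]
      simple_graded_module.finite_dim_iff_dominant[OF module]
    unfolding is_L_def by blast
qed

end
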